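(* Let $\mathcal{C}$ be a finite abstract simplicial complex and $\mathcal{M}$ a matroid on the same finite ground set $V$, and let $d\ge 0$ be an integer. If $\mathcal{C}$ is $d$-Leray and $r(\mathcal{M}[V\setminus A])\ge d+2$ for all $A\in\mathcal{C}$, then $\mathbf{RG}(\mathcal{C}^\star,\mathcal{M}^* )$ is connected.
   Context: $\mathcal{C}[X]=\{\sigma\in\mathcal{C}:\sigma\subseteq X\}$, $\mathcal{M}[X]=\{A\in\mathcal{M}:A\subseteq X\}$, $r$ is matroid rank. $\mathcal{C}$ is $d$-Leray if $\widetilde H_i(\mathcal{C}[X];\mathbb{Q})=0$ for all $X\subseteq V$ and all $i\ge d$. The Alexander dual is $\mathcal{C}^\star=\{X\subseteq V: V\setminus X\notin\mathcal{C}\}$. The dual matroid is $\mathcal{M}^*=\{A\subseteq V: r(\mathcal{M}[V\setminus A])=r(\mathcal{M})\}$. For a complex $\mathcal{D}$ and matroid $\mathcal{N}$ on $V$, $\mathbf{RG}(\mathcal{D},\mathcal{N})$ is the graph whose vertices are the bases of $\mathcal{N}$ that are simplices of $\mathcal{D}$, two being adjacent if their union is a simplex of $\mathcal{D}$ of cardinality $r(\mathcal{N})+1$. *)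

theory Defs
  imports Complex_Main
begin

definition simplicial_complex :: "'a set \<Rightarrow> 'a set set \<Rightarrow> bool" where
  "simplicial_complex V C \<longleftrightarrow> finite V \<and> (\<forall>\<sigma>\<in>C. \<sigma> \<subseteq> V) \<and>
     (\<forall>\<sigma>\<in>C. \<forall>\<tau>. \<tau> \<subseteq> \<sigma> \<longrightarrow> \<tau> \<in> C)"

definition induced :: "'a set set \<Rightarrow> 'a set \<Rightarrow> 'a set set" where
  "induced C X = {\<sigma>\<in>C. \<sigma> \<subseteq> X}"

(* Simplicial chains with rational coefficients: an i-chain assigns a coefficient to
   each i-face (faces of cardinality i+1), oriented by the linear order on vertices.
   The empty face is the (-1)-face, giving the augmented (reduced) chain complex. *)
definition chains :: "'a set set \<Rightarrow> nat \<Rightarrow> ('a set \<Rightarrow> rat) set" where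
  "chains K i = {c. \<forall>\<sigma>. c \<sigma> \<noteq> 0 \<longrightarrow> \<sigma> \<in> K \<and> card \<sigma> = i + 1}"

definition bd :: "'a::linorder set set \<Rightarrow> ('a set \<Rightarrow> rat) \<Rightarrow> 'a set \<Rightarrow> rat" where
  "bd K c \<tau> = (if \<tau> \<in> K then
      (\<Sum>v\<in>{v. v \<notin> \<tau> \<and> insert v \<tau> \<in> K}.
          (-1) ^ card {u\<in>\<tau>. u < v} * c (insert v \<tau>))
    else 0)"

definition reduced_homology_vanishes :: "'a::linorder set set \<Rightarrow> nat \<Rightarrow> bool" where
  "reduced_homology_vanishes K i \<longleftrightarrow>
     (\<forall>c\<in>chains K i. bd K c = (\<lambda>_. 0) \<longrightarrow> (\<exists>b\<in>chains K (Suc i). bd K b = c))"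

definition leray :: "'a::linorder set \<Rightarrow> 'a set set \<Rightarrow> nat \<Rightarrow> bool" where
  "leray V C d \<longleftrightarrow> (\<forall>X\<subseteq>V. \<forall>i\<ge>d. reduced_homology_vanishes (induced C X) i)"

definition alexander_dual :: "'a set \<Rightarrow> 'a set set \<Rightarrow> 'a set set" where
  "alexander_dual V C = {X. X \<subseteq> V \<and> V - X \<notin> C}"

definition matroid :: "'a set \<Rightarrow> 'a set set \<Rightarrow> bool" where
  "matroid V M \<longleftrightarrow> finite V \<and> (\<forall>A\<in>M. A \<subseteq> V) \<and> {} \<in> M \<and>
     (\<forall>A\<in>M. \<forall>B. B \<subseteq> A \<longrightarrow> B \<in> M) \<and>
     (\<forall>A\<in>M. \<forall>B\<in>M. card A < card B \<longrightarrow> (\<exists>x\<in>B - A. insert x A \<in> M))"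

definition mrank :: "'a set set \<Rightarrow> 'a set \<Rightarrow> nat" where
  "mrank M X = Max (card ` {A\<in>M. A \<subseteq> X})"

definition dual_matroid :: "'a set \<Rightarrow> 'a set set \<Rightarrow> 'a set set" where
  "dual_matroid V M = {A. A \<subseteq> V \<and> mrank M (V - A) = mrank M V}"

definition bases :: "'a set \<Rightarrow> 'a set set \<Rightarrow> 'a set set" where
  "bases V N = {B\<in>N. card B = mrank N V}"

definition RG_vertices :: "'a set \<Rightarrow> 'a set set \<Rightarrow> 'a set set \<Rightarrow> 'a set set" where
  "RG_vertices V D N = {B\<in>bases V N. B \<in> D}"

definition RG_adj :: "'a set \<Rightarrow> 'a set set \<Rightarrow> 'a set set \<Rightarrow> 'a set \<Rightarrow> 'a set \<Rightarrow> bool" where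
  "RG_adj V D N B B' \<longleftrightarrow> B \<in> RG_vertices V D N \<and> B' \<in> RG_vertices V D N \<and>
     B \<union> B' \<in> D \<and> card (B \<union> B') = mrank N V + 1"

definition RG_connected :: "'a set \<Rightarrow> 'a set set \<Rightarrow> 'a set set \<Rightarrow> bool" where
  "RG_connected V D N \<longleftrightarrow>
     (\<forall>B\<in>RG_vertices V D N. \<forall>B'\<in>RG_vertices V D N. (RG_adj V D N)\<^sup>*\<^sup>* B B')"

end

theory Submission
  imports Defs
begin

text \<open>
  Passing to complements, the vertices of the graph become the bases of \<open>M\<close> outside \<open>C\<close>, two being
  adjacent when they meet in an independent set of size \<open>r(M) - 1\<close> outside \<open>C\<close>. Bases containing a
  common set outside \<open>C\<close> lie in one component, so a component determines a set \<open>U\<close> of independent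
  sets outside \<open>C\<close> that is closed under passing to larger independent sets and to subsets outside \<open>C\<close>.
  Suppose that \<open>B\<close> lies in \<open>U\<close> but \<open>B'\<close> does not.

  Consider families \<open>\<phi>(X, A)\<close> of chains, indexed by faces \<open>X \<subseteq> A\<close> of \<open>C\<close>, where \<open>\<phi>(X, A)\<close> avoids \<open>X\<close>,
  has simplices of size \<open>|A - X| + 1\<close>, and \<open>\<partial>\<phi>(X, A) = [A = X] \<emptyset> - E\<phi>(X, A)\<close>; here \<open>E\<close> is a
  differential acting on the indices. No such family can have all its values in \<open>C\<close>: its members with
  \<open>X = \<emptyset>\<close> would be a null-homotopy of a chain map whose only nonzero diagonal entry is the one at the
  empty face, and the alternating trace would give \<open>0 = 1\<close>. But the hypotheses produce one. The simplices on
  \<open>B - X\<close> and \<open>B' - X\<close> carry families \<open>\<psi>\<close> and \<open>\<psi>'\<close>. By the rank condition the matroid complex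
  \<open>M[V - X]\<close> is acyclic up to dimension \<open>d\<close>, which gives a homotopy \<open>H\<close> between them for \<open>|A - X| \<le> d\<close>.
  Correcting \<open>\<psi>\<close> by the part of \<open>H\<close> supported on \<open>U\<close> pushes it into \<open>C\<close>, and the Leray property
  extends the result to all \<open>|A - X| > d\<close>.
\<close>

subsection \<open>Reduced chains on subsets of an ambient vertex set\<close>

definition sgn_at :: "'a::linorder \<Rightarrow> 'a set \<Rightarrow> rat" where
  "sgn_at v \<tau> = (-1) ^ card {u\<in>\<tau>. u < v}"

text \<open>The sum runs over an ambient vertex set rather than over the faces of a complex, so one
  operator serves all subcomplexes; on chains of a complex \<open>K\<close> on \<open>V\<close> it
  agrees with \<open>bd K\<close>.\<close>

definition bnd :: "'a::linorder set \<Rightarrow> ('a set \<Rightarrow> rat) \<Rightarrow> 'a set \<Rightarrow> rat" where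
  "bnd V c \<tau> = (\<Sum>v\<in>V - \<tau>. sgn_at v \<tau> * c (insert v \<tau>))"

text \<open>Degree is cardinality, one more than dimension. Degree 0 holds the multiples of the
  empty face, so the augmentation needs no separate treatment.\<close>

definition chn :: "'a set set \<Rightarrow> nat \<Rightarrow> ('a set \<Rightarrow> rat) set" where
  "chn K n = {c. \<forall>\<sigma>. c \<sigma> \<noteq> 0 \<longrightarrow> \<sigma> \<in> K \<and> card \<sigma> = n}"

definition fills :: "'a::linorder set \<Rightarrow> 'a set set \<Rightarrow> nat \<Rightarrow> bool" where
  "fills V K n \<longleftrightarrow>
     (\<forall>c\<in>chn K n. bnd V c = (\<lambda>_. 0) \<longrightarrow> (\<exists>b\<in>chn K (Suc n). bnd V b = c))"

definition cone :: "'a::linorder \<Rightarrow> ('a set \<Rightarrow> rat) \<Rightarrow> 'a set \<Rightarrow> rat" where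
  "cone v c \<sigma> = (if v \<in> \<sigma> then sgn_at v \<sigma> * c (\<sigma> - {v}) else 0)"

lemma sgn_at_insert:
  assumes "finite \<tau>" "u \<notin> \<tau>"
  shows "sgn_at v (insert u \<tau>) = (if u < v then - sgn_at v \<tau> else sgn_at v \<tau>)"
proof -
  have "{w\<in>insert u \<tau>. w < v} = (if u < v then insert u {w\<in>\<tau>. w < v} else {w\<in>\<tau>. w < v})"
    by auto
  then show ?thesis
    using assms by (simp add: sgn_at_def)
qed

lemma sgn_at_insert_self [simp]: "sgn_at v (insert v \<tau>) = sgn_at v \<tau>"
  unfolding sgn_at_def by (rule arg_cong[where f = "\<lambda>S. (-1) ^ card S"]) auto

lemma sgn_at_remove_self [simp]: "sgn_at v (\<tau> - {v}) = sgn_at v \<tau>"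
  unfolding sgn_at_def by (rule arg_cong[where f = "\<lambda>S. (-1) ^ card S"]) auto

lemma sgn_at_square [simp]: "sgn_at v \<tau> * sgn_at v \<tau> = 1"
  by (simp add: sgn_at_def flip: power_mult_distrib)

lemma sgn_at_square_left [simp]: "sgn_at v \<tau> * (sgn_at v \<tau> * x) = x"
  by (simp flip: mult.assoc)

lemma sgn_at_swap_insert:
  assumes "finite \<tau>" "u \<notin> \<tau>" "v \<notin> \<tau>" "u \<noteq> v"
  shows "sgn_at u \<tau> * sgn_at v (insert u \<tau>) = - (sgn_at v \<tau> * sgn_at u (insert v \<tau>))"
  using assms by (auto simp: sgn_at_insert)

lemma sgn_at_swap_remove:
  assumes "finite \<tau>" "u \<in> \<tau>" "v \<in> \<tau>" "u \<noteq> v"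
  shows "sgn_at u \<tau> * sgn_at v (\<tau> - {u}) = - (sgn_at v \<tau> * sgn_at u (\<tau> - {v}))"
proof -
  define \<rho> where "\<rho> = \<tau> - {u, v}"
  have \<rho>: "finite \<rho>" "u \<notin> \<rho>" "v \<notin> \<rho>" and \<tau>: "\<tau> = insert u (insert v \<rho>)"
    using assms by (auto simp: \<rho>_def)
  have "\<tau> - {u} = insert v \<rho>" "\<tau> - {v} = insert u \<rho>"
    using \<rho> \<tau> assms by auto
  moreover have "sgn_at v \<tau> = sgn_at v (insert u \<rho>)"
    unfolding \<tau> by (subst insert_commute) simp
  moreover have "sgn_at u \<tau> = sgn_at u (insert v \<rho>)"
    unfolding \<tau> by simp
  ultimately show ?thesis
    using sgn_at_swap_insert[OF \<rho> assms(4)] by (simp add: mult.commute)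
qed

text \<open>Swapping the two summations turns the sum into its negative. Both \<open>bnd_bnd\<close>
  and \<open>shift_shift\<close> reduce to this.\<close>

lemma sum_antisymmetric:
  fixes g :: "'a \<Rightarrow> 'a \<Rightarrow> rat"
  assumes "finite S" and "\<And>x y. x \<in> S \<Longrightarrow> y \<in> S \<Longrightarrow> x \<noteq> y \<Longrightarrow> g x y = - g y x"
  shows "(\<Sum>x\<in>S. \<Sum>y\<in>S - {x}. g x y) = 0"
proof -
  define T where "T = (\<Sum>x\<in>S. \<Sum>y\<in>S - {x}. g x y)"
  have restrict: "(\<Sum>y\<in>S - {x}. h x y) = (\<Sum>y\<in>S. if x = y then 0 else h x y)"
    for x and h :: "'a \<Rightarrow> 'a \<Rightarrow> rat"
    using assms(1) by (intro sum.mono_neutral_cong_left) auto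
  have "T = (\<Sum>x\<in>S. \<Sum>y\<in>S. if x = y then 0 else g x y)"
    by (simp add: T_def restrict)
  also have "\<dots> = (\<Sum>y\<in>S. \<Sum>x\<in>S. if x = y then 0 else g x y)"
    by (rule sum.swap)
  also have "\<dots> = (\<Sum>y\<in>S. \<Sum>x\<in>S. - (if y = x then 0 else g y x))"
  proof (intro sum.cong refl)
    fix x y assume "x \<in> S" "y \<in> S"
    then show "(if x = y then 0 else g x y) = - (if y = x then 0 else g y x)"
      using assms(2)[of x y] by simp
  qed
  also have "\<dots> = - T"
    by (simp add: T_def restrict sum_negf)
  finally show ?thesis
    by (simp add: T_def)
qed

lemma chnI: "(\<And>\<sigma>. c \<sigma> \<noteq> 0 \<Longrightarrow> \<sigma> \<in> K \<and> card \<sigma> = n) \<Longrightarrow> c \<in> chn K n"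
  by (auto simp: chn_def)

lemma chnD: "c \<in> chn K n \<Longrightarrow> \<sigma> \<notin> K \<or> card \<sigma> \<noteq> n \<Longrightarrow> c \<sigma> = 0"
  by (auto simp: chn_def)

lemma chn_mono: "c \<in> chn K n \<Longrightarrow> K \<subseteq> L \<Longrightarrow> c \<in> chn L n"
  by (auto simp: chn_def)

lemma chn_add: "b \<in> chn K n \<Longrightarrow> c \<in> chn K n \<Longrightarrow> (\<lambda>\<sigma>. b \<sigma> + c \<sigma>) \<in> chn K n"
  by (rule chnI) (metis (no_types, lifting) chnD add_0)

lemma chn_scale: "c \<in> chn K n \<Longrightarrow> (\<lambda>\<sigma>. k * c \<sigma>) \<in> chn K n"
  by (auto simp: chn_def)

lemma chn_diff: "b \<in> chn K n \<Longrightarrow> c \<in> chn K n \<Longrightarrow> (\<lambda>\<sigma>. b \<sigma> - c \<sigma>) \<in> chn K n"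
  by (rule chnI) (metis (no_types, lifting) chnD diff_0_right)

lemma chn_sum:
  assumes "\<And>x. x \<in> S \<Longrightarrow> c x \<in> chn K n"
  shows "(\<lambda>\<sigma>. \<Sum>x\<in>S. c x \<sigma>) \<in> chn K n"
proof (rule chnI)
  fix \<sigma> assume "(\<Sum>x\<in>S. c x \<sigma>) \<noteq> 0"
  then obtain x where "x \<in> S" "c x \<sigma> \<noteq> 0"
    using sum.not_neutral_contains_not_neutral by blast
  then show "\<sigma> \<in> K \<and> card \<sigma> = n"
    using assms chnD by blast
qed

lemma bnd_add: "bnd V (\<lambda>\<sigma>. b \<sigma> + c \<sigma>) \<tau> = bnd V b \<tau> + bnd V c \<tau>"
  by (simp add: bnd_def distrib_left sum.distrib)

lemma bnd_diff: "bnd V (\<lambda>\<sigma>. b \<sigma> - c \<sigma>) \<tau> = bnd V b \<tau> - bnd V c \<tau>"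
  by (simp add: bnd_def right_diff_distrib sum_subtractf)

lemma bnd_scale: "bnd V (\<lambda>\<sigma>. k * c \<sigma>) \<tau> = k * bnd V c \<tau>"
  by (simp add: bnd_def sum_distrib_left mult.left_commute)

lemma bnd_sum: "bnd V (\<lambda>\<sigma>. \<Sum>x\<in>S. c x \<sigma>) \<tau> = (\<Sum>x\<in>S. bnd V (c x) \<tau>)"
  unfolding bnd_def sum_distrib_left by (rule sum.swap)

lemma chn_bnd:
  assumes "finite V" "K \<subseteq> Pow V" "\<And>\<sigma> \<tau>. \<sigma> \<in> K \<Longrightarrow> \<tau> \<subseteq> \<sigma> \<Longrightarrow> \<tau> \<in> K" "c \<in> chn K (Suc n)"
  shows "bnd V c \<in> chn K n"
proof (rule chnI)
  fix \<tau> assume "bnd V c \<tau> \<noteq> 0"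
  then obtain v where v: "v \<in> V - \<tau>" "c (insert v \<tau>) \<noteq> 0"
    unfolding bnd_def by (metis (no_types, lifting) mult_zero_right sum.not_neutral_contains_not_neutral)
  then have K: "insert v \<tau> \<in> K" "card (insert v \<tau>) = Suc n"
    using assms(4) by (auto simp: chn_def)
  then have "finite \<tau>"
    using assms(1,2) by (meson Pow_iff finite_insert finite_subset subsetD)
  with K v show "\<tau> \<in> K \<and> card \<tau> = n"
    using assms(3)[OF K(1)] by auto
qed

lemma bnd_outside:
  assumes "c \<in> chn K n" "K \<subseteq> Pow V" "\<not> \<tau> \<subseteq> V"
  shows "bnd V c \<tau> = 0"
  unfolding bnd_def
proof (rule sum.neutral, rule ballI)
  fix v
  have "insert v \<tau> \<notin> K"
    using assms(2,3) by auto
  then show "sgn_at v \<tau> * c (insert v \<tau>) = 0"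
    using chnD[OF assms(1)] by simp
qed

lemma bnd_bnd:
  assumes "finite V" "K \<subseteq> Pow V" "c \<in> chn K n"
  shows "bnd V (bnd V c) = (\<lambda>_. 0)"
proof
  fix \<tau>
  show "bnd V (bnd V c) \<tau> = 0"
  proof (cases "\<tau> \<subseteq> V")
    case True
    then have fin: "finite \<tau>"
      using assms(1) finite_subset by blast
    have "bnd V (bnd V c) \<tau> = (\<Sum>v\<in>V - \<tau>. \<Sum>u\<in>V - \<tau> - {v}.
        sgn_at v \<tau> * sgn_at u (insert v \<tau>) * c (insert u (insert v \<tau>)))"
      by (simp add: bnd_def sum_distrib_left mult.assoc Diff_insert[symmetric])
    also have "\<dots> = 0"
    proof (rule sum_antisymmetric)
      fix x y assume "x \<in> V - \<tau>" "y \<in> V - \<tau>" "x \<noteq> y"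
      then show "sgn_at x \<tau> * sgn_at y (insert x \<tau>) * c (insert y (insert x \<tau>)) =
          - (sgn_at y \<tau> * sgn_at x (insert y \<tau>) * c (insert x (insert y \<tau>)))"
        using sgn_at_swap_insert[OF fin, of x y] by (simp add: insert_commute)
    qed (use assms in simp)
    finally show ?thesis .
  next
    case False
    have "bnd V c (insert v \<tau>) = 0" for v
      using False by (intro bnd_outside[OF assms(3,2)]) auto
    then show ?thesis
      by (simp add: bnd_def[of V "bnd V c"])
  qed
qed

section \<open>Cones and fillings\<close>

lemma chn_cone:
  assumes "c \<in> chn K n" "K \<subseteq> Pow V" "finite V" "\<And>\<sigma>. \<sigma> \<in> K \<Longrightarrow> v \<notin> \<sigma> \<Longrightarrow> card \<sigma> = n \<Longrightarrow> insert v \<sigma> \<in> L"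
  shows "cone v c \<in> chn L (Suc n)"
proof (rule chnI)
  fix \<sigma> assume "cone v c \<sigma> \<noteq> 0"
  then have v: "v \<in> \<sigma>" and "c (\<sigma> - {v}) \<noteq> 0"
    by (auto simp: cone_def split: if_splits)
  then have K: "\<sigma> - {v} \<in> K" "card (\<sigma> - {v}) = n"
    using assms(1) by (auto simp: chn_def)
  then have "finite (\<sigma> - {v})"
    using assms(2,3) by (meson Pow_iff finite_subset subsetD)
  moreover have "insert v (\<sigma> - {v}) = \<sigma>"
    using v by auto
  ultimately show "\<sigma> \<in> L \<and> card \<sigma> = Suc n"
    using assms(4)[OF K(1)] K(2) by (metis Diff_iff card_insert_disjoint insertI1)
qed

text \<open>Coning from \<open>v\<close> is a contracting homotopy of the augmented chain complex.
  At a face without \<open>v\<close> only the term \<open>u = v\<close> survives; at a face through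
  \<open>v\<close>, moving \<open>u\<close> past \<open>v\<close> flips every sign. In particular
  the cone over a cycle fills it.\<close>

lemma bnd_cone:
  assumes "finite V" "K \<subseteq> Pow V" "c \<in> chn K n" "v \<in> V"
  shows "bnd V (cone v c) \<tau> = c \<tau> - cone v (bnd V c) \<tau>"
proof (cases "v \<in> \<tau>")
  case False
  then have "bnd V (cone v c) \<tau> = (\<Sum>u\<in>V - \<tau>. if u = v then c \<tau> else 0)"
    unfolding bnd_def by (intro sum.cong) (auto simp: cone_def)
  also have "\<dots> = c \<tau>"
    using False assms by simp
  finally show ?thesis
    using False by (simp add: cone_def)
next
  case True
  define \<rho> where "\<rho> = \<tau> - {v}"
  have \<rho>: "v \<notin> \<rho>" "\<tau> = insert v \<rho>"
    using True by (auto simp: \<rho>_def)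
  show ?thesis
  proof (cases "\<tau> \<subseteq> V")
    case False
    have "cone v c (insert u \<tau>) = 0" for u
      using False True chnD[OF assms(3), of "insert u \<tau> - {v}"] assms(2,4)
      by (cases "insert u \<tau> - {v} \<in> K") (auto simp: cone_def)
    moreover have "bnd V c \<rho> = 0"
      using False \<rho> assms(4) by (intro bnd_outside[OF assms(3,2)]) auto
    moreover have "c \<tau> = 0"
      using chnD[OF assms(3)] False assms(2) by blast
    ultimately show ?thesis
      by (simp add: bnd_def[of V "cone v c"] cone_def[of v "bnd V c"] \<rho>_def)
  next
    case \<tau>V: True
    then have fin: "finite \<rho>"
      using assms(1) \<rho> by (metis finite_insert finite_subset)
    have "bnd V (cone v c) \<tau> = (\<Sum>u\<in>V - \<tau>. - (sgn_at v \<rho> * (sgn_at u \<rho> * c (insert u \<rho>))))"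
      unfolding bnd_def
    proof (rule sum.cong[OF refl])
      fix u assume u: "u \<in> V - \<tau>"
      then have "insert u \<tau> - {v} = insert u \<rho>"
        using \<rho> by auto
      moreover have "sgn_at u \<tau> * sgn_at v (insert u \<tau>) = - (sgn_at v \<rho> * sgn_at u \<rho>)"
      proof -
        have "sgn_at v (insert u \<tau>) = sgn_at v (insert u \<rho>)"
          unfolding \<rho>(2) by (subst insert_commute) simp
        then show ?thesis
          using u \<rho> fin sgn_at_insert[of \<rho>] by (auto simp: mult.commute)
      qed
      ultimately show "sgn_at u \<tau> * cone v c (insert u \<tau>) =
          - (sgn_at v \<rho> * (sgn_at u \<rho> * c (insert u \<rho>)))"
        using True by (simp add: cone_def flip: mult.assoc)
    qed
    also have "\<dots> = - (sgn_at v \<rho> * (bnd V c \<rho> - sgn_at v \<rho> * c \<tau>))"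
    proof -
      have "V - \<rho> = insert v (V - \<tau>)"
        using \<rho> assms(4) by auto
      moreover have "v \<notin> V - \<tau>"
        using True by simp
      ultimately have "bnd V c \<rho> = sgn_at v \<rho> * c \<tau> + (\<Sum>u\<in>V - \<tau>. sgn_at u \<rho> * c (insert u \<rho>))"
        using assms(1) by (simp add: bnd_def flip: \<rho>(2))
      then show ?thesis
        by (simp add: sum_negf sum_distrib_left)
    qed
    also have "\<dots> = c \<tau> - cone v (bnd V c) \<tau>"
      using True by (simp add: cone_def \<rho>_def right_diff_distrib)
    finally show ?thesis .
  qed
qed

lemma fills_Pow:
  assumes "finite V" "Y \<subseteq> V" "Y \<noteq> {}"
  shows "fills V (Pow Y) n"
  unfolding fills_def
proof (intro ballI impI)
  fix c assume c: "c \<in> chn (Pow Y) n" "bnd V c = (\<lambda>_. 0)"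
  obtain v where v: "v \<in> Y"
    using assms(3) by blast
  have K: "Pow Y \<subseteq> Pow V"
    using assms(2) by auto
  have "cone v c \<in> chn (Pow Y) (Suc n)"
    using v by (intro chn_cone[OF c(1) K assms(1)]) auto
  moreover have "bnd V (cone v c) = c"
    using bnd_cone[OF assms(1) K c(1), of v] v assms(2) c(2)
    by (auto simp: fun_eq_iff cone_def)
  ultimately show "\<exists>b\<in>chn (Pow Y) (Suc n). bnd V b = c"
    by blast
qed

lemma fills_of_reduced_homology_vanishes:
  assumes "finite V" "K \<subseteq> Pow V" "\<And>\<sigma> \<tau>. \<sigma> \<in> K \<Longrightarrow> \<tau> \<subseteq> \<sigma> \<Longrightarrow> \<tau> \<in> K"
    and "reduced_homology_vanishes K i"
  shows "fills V K (Suc i)"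
proof -
  \<comment> \<open>The vertices omitted by \<open>bd\<close> lead to sets outside \<open>K\<close>,
    where \<open>c\<close> vanishes; at \<open>\<tau>\<close> outside \<open>K\<close>, downward
    closure makes every term vanish.\<close>
  have bd: "bd K c = bnd V c" if c: "c \<in> chn K n" for c n
  proof
    fix \<tau>
    show "bd K c \<tau> = bnd V c \<tau>"
    proof (cases "\<tau> \<in> K")
      case True
      have "(\<Sum>v\<in>{v. v \<notin> \<tau> \<and> insert v \<tau> \<in> K}. sgn_at v \<tau> * c (insert v \<tau>)) = bnd V c \<tau>"
        unfolding bnd_def
        using assms(1,2) chnD[OF c] by (intro sum.mono_neutral_left) auto
      then show ?thesis
        using True by (simp add: bd_def sgn_at_def)
    next
      case False
      then have "insert v \<tau> \<notin> K" for v
        using assms(3) by blast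
      then show ?thesis
        using False chnD[OF c] by (simp add: bd_def bnd_def)
    qed
  qed
  have "chains K j = chn K (Suc j)" for j
    by (simp add: chains_def chn_def)
  then show ?thesis
    using assms(4) bd by (simp add: fills_def reduced_homology_vanishes_def)
qed

subsection \<open>Families of chains indexed by nested pairs of faces\<close>

text \<open>
  The index differential \<open>E\<close> on families over pairs \<open>X \<subseteq> A\<close>: a vertex of \<open>A - X\<close> is either deleted from
  \<open>A\<close> or added to \<open>X\<close>. The sign of the second kind of term makes \<open>E\<close> square to zero.
\<close>

definition shift ::
  "('a::linorder set \<Rightarrow> 'a set \<Rightarrow> 'b \<Rightarrow> rat) \<Rightarrow> 'a set \<Rightarrow> 'a set \<Rightarrow> 'b \<Rightarrow> rat" where
  "shift \<phi> X A \<tau> = (\<Sum>x\<in>A - X. sgn_at x A * \<phi> X (A - {x}) \<tau> +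
     (-1) ^ card (A - X) * (sgn_at x X * \<phi> (insert x X) A \<tau>))"

lemma shift_add:
  "shift (\<lambda>X A \<tau>. \<phi> X A \<tau> + \<psi> X A \<tau>) X A \<tau> = shift \<phi> X A \<tau> + shift \<psi> X A \<tau>"
  by (simp add: shift_def sum.distrib[symmetric] algebra_simps)

lemma shift_diff:
  "shift (\<lambda>X A \<tau>. \<phi> X A \<tau> - \<psi> X A \<tau>) X A \<tau> = shift \<phi> X A \<tau> - shift \<psi> X A \<tau>"
  by (simp add: shift_def sum_subtractf[symmetric] algebra_simps)

lemma shift_scale:
  "shift (\<lambda>X A \<tau>. k * \<phi> X A \<tau>) X A \<tau> = k * shift \<phi> X A \<tau>"
  by (simp add: shift_def sum_distrib_left algebra_simps)

lemma bnd_shift: "bnd V (shift \<phi> X A) \<tau> = shift (\<lambda>X A. bnd V (\<phi> X A)) X A \<tau>"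
  unfolding shift_def[abs_def] by (simp add: bnd_sum bnd_add bnd_scale)

lemma shift_cong:
  assumes "\<And>x. x \<in> A - X \<Longrightarrow> \<phi> X (A - {x}) \<tau> = \<psi> X (A - {x}) \<tau>"
    and "\<And>x. x \<in> A - X \<Longrightarrow> \<phi> (insert x X) A \<tau> = \<psi> (insert x X) A \<tau>"
  shows "shift \<phi> X A \<tau> = shift \<psi> X A \<tau>"
  unfolding shift_def using assms by (intro sum.cong) auto

lemma chn_shift:
  assumes "\<And>x. x \<in> A - X \<Longrightarrow> \<phi> X (A - {x}) \<in> chn K n"
    and "\<And>x. x \<in> A - X \<Longrightarrow> \<phi> (insert x X) A \<in> chn K n"
  shows "shift \<phi> X A \<in> chn K n"
  unfolding shift_def[abs_def]
  using assms by (intro chn_sum chn_add chn_scale) auto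

text \<open>Two deletions, or two additions, cancel by the swap rules for signs. A deletion and an
  addition in either order cancel because \<open>(-1) ^ card (A - X)\<close> changes sign once
  \<open>A - X\<close> has lost a vertex.\<close>

lemma shift_shift:
  assumes "finite A" "X \<subseteq> A"
  shows "shift (shift \<phi>) X A \<tau> = 0"
proof -
  define S where "S = A - X"
  define q :: rat where "q = (-1) ^ card S"
  define g where "g x y = sgn_at x A * (sgn_at y (A - {x}) * \<phi> X (A - {x} - {y}) \<tau>)
      - q * (sgn_at x A * (sgn_at y X * \<phi> (insert y X) (A - {x}) \<tau>))
      + q * (sgn_at x X * (sgn_at y A * \<phi> (insert x X) (A - {y}) \<tau>))
      - q * (q * (sgn_at x X * (sgn_at y (insert x X) * \<phi> (insert y (insert x X)) A \<tau>)))"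
    for x y
  have fin: "finite S" "finite X"
    using assms by (auto simp: S_def finite_subset)
  have "shift (shift \<phi>) X A \<tau> = (\<Sum>x\<in>S. sgn_at x A * shift \<phi> X (A - {x}) \<tau> +
      q * (sgn_at x X * shift \<phi> (insert x X) A \<tau>))"
    by (simp only: shift_def[of "shift \<phi>"] S_def q_def)
  also have "\<dots> = (\<Sum>x\<in>S. \<Sum>y\<in>S - {x}. g x y)"
  proof (rule sum.cong[OF refl])
    fix x assume x: "x \<in> S"
    have sets: "A - {x} - X = S - {x}" "A - insert x X = S - {x}"
      by (auto simp: S_def)
    have "card S = Suc (card (S - {x}))"
      using card_Suc_Diff1[OF fin(1) x] by simp
    then have q: "(-1) ^ card (S - {x}) = - q"
      by (simp add: q_def)
    show "sgn_at x A * shift \<phi> X (A - {x}) \<tau> + q * (sgn_at x X * shift \<phi> (insert x X) A \<tau>) =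
        (\<Sum>y\<in>S - {x}. g x y)"
      unfolding shift_def sets q sum_distrib_left sum.distrib[symmetric]
      by (rule sum.cong[OF refl]) (simp add: g_def algebra_simps)
  qed
  also have "\<dots> = 0"
  proof (rule sum_antisymmetric[OF fin(1)])
    fix x y assume xy: "x \<in> S" "y \<in> S" "x \<noteq> y"
    have "sgn_at x A * (sgn_at y (A - {x}) * t) = - (sgn_at y A * (sgn_at x (A - {y}) * t))" for t
      using sgn_at_swap_remove[OF assms(1), of x y] xy
      by (simp add: S_def flip: mult.assoc)
    moreover have "sgn_at x X * (sgn_at y (insert x X) * t) =
        - (sgn_at y X * (sgn_at x (insert y X) * t))" for t
      using sgn_at_swap_insert[OF fin(2), of x y] xy
      by (simp add: S_def flip: mult.assoc)
    moreover have "A - {x} - {y} = A - {y} - {x}"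
      by auto
    moreover have "insert y (insert x X) = insert x (insert y X)"
      by auto
    ultimately show "g x y = - g y x"
      unfolding g_def by (simp add: mult.left_commute)
  qed
  finally show ?thesis .
qed

text \<open>
  Induction on \<open>|A - X|\<close>: the hypothesis on \<open>\<beta>\<close> says exactly that the right-hand side is a cycle, so a
  filling in \<open>G X\<close> exists. The family \<open>init\<close> prescribes the solution for \<open>|A - X| < m\<close>.
\<close>

lemma shift_equation_extend:
  fixes V :: "'a::linorder set" and s :: rat and k m N :: nat
  assumes V: "finite V" "C \<subseteq> Pow V" "\<And>A B. A \<in> C \<Longrightarrow> B \<subseteq> A \<Longrightarrow> B \<in> C"
    and anti: "\<And>X Y. X \<subseteq> Y \<Longrightarrow> G Y \<subseteq> G X"
    and fill: "\<And>X A. X \<subseteq> A \<Longrightarrow> A \<in> C \<Longrightarrow> m \<le> card (A - X) \<Longrightarrow> card (A - X) \<le> N \<Longrightarrow>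
      fills V (G X) (card (A - X) + k)"
    and \<beta>: "\<And>X A. X \<subseteq> A \<Longrightarrow> A \<in> C \<Longrightarrow> card (A - X) \<le> N \<Longrightarrow> \<beta> X A \<in> chn (G X) (card (A - X) + k)"
    and bnd_\<beta>: "\<And>X A \<tau>. X \<subseteq> A \<Longrightarrow> A \<in> C \<Longrightarrow> card (A - X) \<le> N \<Longrightarrow>
      bnd V (\<beta> X A) \<tau> = - s * shift \<beta> X A \<tau>"
    and init: "\<And>X A. X \<subseteq> A \<Longrightarrow> A \<in> C \<Longrightarrow> card (A - X) < m \<Longrightarrow> card (A - X) \<le> N \<Longrightarrow>
      init X A \<in> chn (G X) (Suc (card (A - X) + k)) \<and>
      bnd V (init X A) = (\<lambda>\<tau>. \<beta> X A \<tau> + s * shift init X A \<tau>)"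
  obtains \<phi> where "\<And>X A. X \<subseteq> A \<Longrightarrow> A \<in> C \<Longrightarrow> card (A - X) \<le> N \<Longrightarrow>
      \<phi> X A \<in> chn (G X) (Suc (card (A - X) + k)) \<and>
      bnd V (\<phi> X A) = (\<lambda>\<tau>. \<beta> X A \<tau> + s * shift \<phi> X A \<tau>)"
proof -
  define good where "good \<phi> X A \<longleftrightarrow> \<phi> X A \<in> chn (G X) (Suc (card (A - X) + k)) \<and>
      bnd V (\<phi> X A) = (\<lambda>\<tau>. \<beta> X A \<tau> + s * shift \<phi> X A \<tau>)"
    for \<phi> and X A :: "'a set"
  have fin: "finite A" if "A \<in> C" for A
    using that V(1,2) by (meson Pow_iff finite_subset subsetD)
  have cards: "card (A - {x} - X) = card (A - X) - 1" "card (A - insert x X) = card (A - X) - 1"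
    "card (A - X) > 0" if "A \<in> C" "x \<in> A - X" for A X x
  proof -
    have "A - {x} - X = (A - X) - {x}" "A - insert x X = (A - X) - {x}"
      by auto
    then show "card (A - {x} - X) = card (A - X) - 1" "card (A - insert x X) = card (A - X) - 1"
      "card (A - X) > 0"
      using that fin[OF that(1)] by (auto simp: card_gt_0_iff)
  qed
  have "\<exists>\<phi>. \<forall>X A. X \<subseteq> A \<longrightarrow> A \<in> C \<longrightarrow> card (A - X) < m + j \<longrightarrow> card (A - X) \<le> N \<longrightarrow> good \<phi> X A" for j
  proof (induction j)
    case 0
    then show ?case
      using init by (auto simp: good_def)
  next
    case (Suc j)
    then obtain \<phi> where \<phi>: "\<And>X A. X \<subseteq> A \<Longrightarrow> A \<in> C \<Longrightarrow> card (A - X) < m + j \<Longrightarrow>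
        card (A - X) \<le> N \<Longrightarrow> good \<phi> X A"
      by blast
    have ex: "\<exists>c\<in>chn (G X) (Suc (card (A - X) + k)).
        bnd V c = (\<lambda>\<tau>. \<beta> X A \<tau> + s * shift \<phi> X A \<tau>)"
      if XA: "X \<subseteq> A" "A \<in> C" "card (A - X) = m + j" "card (A - X) \<le> N" for X A
    proof -
      have prev: "good \<phi> X (A - {x})" "good \<phi> (insert x X) A" if "x \<in> A - X" for x
      proof -
        have "A - {x} \<in> C"
          using V(3) XA(2) by blast
        then show "good \<phi> X (A - {x})"
          using that XA cards[OF XA(2) that] by (intro \<phi>) auto
        show "good \<phi> (insert x X) A"
          using that XA cards[OF XA(2) that] by (intro \<phi>) auto
      qed
      have "shift \<phi> X A \<in> chn (G X) (card (A - X) + k)"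
      proof (rule chn_shift)
        fix x assume x: "x \<in> A - X"
        have n: "Suc (card (A - {x} - X) + k) = card (A - X) + k"
          "Suc (card (A - insert x X) + k) = card (A - X) + k"
          using cards[OF XA(2) x] by auto
        show "\<phi> X (A - {x}) \<in> chn (G X) (card (A - X) + k)"
          using prev(1)[OF x] unfolding good_def n by blast
        have "\<phi> (insert x X) A \<in> chn (G (insert x X)) (card (A - X) + k)"
          using prev(2)[OF x] unfolding good_def n by blast
        then show "\<phi> (insert x X) A \<in> chn (G X) (card (A - X) + k)"
          using anti by (rule chn_mono) auto
      qed
      then have "(\<lambda>\<tau>. \<beta> X A \<tau> + s * shift \<phi> X A \<tau>) \<in> chn (G X) (card (A - X) + k)"
        using \<beta>[OF XA(1,2,4)] by (intro chn_add chn_scale)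
      moreover have "bnd V (\<lambda>\<tau>. \<beta> X A \<tau> + s * shift \<phi> X A \<tau>) = (\<lambda>_. 0)"
      proof
        fix \<tau>
        \<comment> \<open>\<open>bnd\<close> commutes with \<open>shift\<close>, and
          \<open>shift\<close> squares to zero, so the boundaries of the earlier layers contribute
          only \<open>shift \<beta>\<close>; this cancels the boundary of
          \<open>\<beta>\<close>.\<close>
        have "shift (\<lambda>X A. bnd V (\<phi> X A)) X A \<tau> =
            shift (\<lambda>X A \<tau>. \<beta> X A \<tau> + s * shift \<phi> X A \<tau>) X A \<tau>"
          using prev by (intro shift_cong) (auto simp: good_def)
        also have "\<dots> = shift \<beta> X A \<tau>"
          by (simp add: shift_add shift_scale shift_shift[OF fin[OF XA(2)] XA(1)])
        finally show "bnd V (\<lambda>\<tau>. \<beta> X A \<tau> + s * shift \<phi> X A \<tau>) \<tau> = 0"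
          using bnd_\<beta> XA by (simp add: bnd_add bnd_scale bnd_shift)
      qed
      moreover have "fills V (G X) (card (A - X) + k)"
        using XA(3) by (intro fill[OF XA(1,2) _ XA(4)]) simp
      ultimately show ?thesis
        unfolding fills_def by blast
    qed
    \<comment> \<open>Only the new layer is redefined. In and below it, \<open>shift\<close> reads
      strictly lower layers, so all the equations survive the change.\<close>
    define \<psi> where "\<psi> X A = (if card (A - X) = m + j
        then SOME c. c \<in> chn (G X) (Suc (card (A - X) + k)) \<and>
          bnd V c = (\<lambda>\<tau>. \<beta> X A \<tau> + s * shift \<phi> X A \<tau>)
        else \<phi> X A)" for X A
    have "good \<psi> X A" if XA: "X \<subseteq> A" "A \<in> C" "card (A - X) < m + Suc j" "card (A - X) \<le> N" for X A
    proof -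
      have same: "shift \<psi> X A = shift \<phi> X A"
      proof
        fix \<tau>
        show "shift \<psi> X A \<tau> = shift \<phi> X A \<tau>"
        proof (rule shift_cong)
          fix x assume x: "x \<in> A - X"
          show "\<psi> X (A - {x}) \<tau> = \<phi> X (A - {x}) \<tau>" "\<psi> (insert x X) A \<tau> = \<phi> (insert x X) A \<tau>"
            using cards[OF XA(2) x] XA(3) by (auto simp: \<psi>_def)
        qed
      qed
      show ?thesis
      proof (cases "card (A - X) = m + j")
        case True
        have "\<psi> X A \<in> chn (G X) (Suc (card (A - X) + k)) \<and>
            bnd V (\<psi> X A) = (\<lambda>\<tau>. \<beta> X A \<tau> + s * shift \<phi> X A \<tau>)"
          using someI_ex[OF ex[OF XA(1,2) True XA(4), unfolded Bex_def]] True
          by (simp add: \<psi>_def)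
        then show ?thesis
          by (simp add: good_def same)
      next
        case False
        then have "\<psi> X A = \<phi> X A"
          by (simp add: \<psi>_def)
        moreover have "good \<phi> X A"
          using False XA by (intro \<phi>) auto
        ultimately show ?thesis
          by (simp add: good_def same)
      qed
    qed
    then show ?case
      by blast
  qed
  from this[of "Suc N"] obtain \<phi>
    where "\<And>X A. X \<subseteq> A \<Longrightarrow> A \<in> C \<Longrightarrow> card (A - X) \<le> N \<Longrightarrow> good \<phi> X A"
    by (metis le_imp_less_Suc trans_less_add2)
  then show ?thesis
    by (intro that) (auto simp: good_def)
qed

section \<open>The unit family and the trace obstruction\<close>

definition unit_family :: "'a set \<Rightarrow> 'a set \<Rightarrow> 'a set \<Rightarrow> rat" where
  "unit_family X A \<tau> = (if A = X \<and> \<tau> = {} then 1 else 0)"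

lemma chn_unit_family:
  assumes "{} \<in> K"
  shows "unit_family X A \<in> chn K (card (A - X))"
  using assms by (auto simp: chn_def unit_family_def)

lemma bnd_unit_family: "bnd V (unit_family X A) \<tau> = 0"
  by (simp add: bnd_def unit_family_def)

text \<open>If \<open>A = insert x X\<close>, deleting \<open>x\<close> from \<open>A\<close> and
  adding it to \<open>X\<close> both reach a diagonal pair, with opposite signs because
  \<open>card (A - X) = 1\<close>. Otherwise neither reaches one.\<close>

lemma shift_unit_family:
  assumes "finite A" "X \<subseteq> A"
  shows "shift unit_family X A \<tau> = 0"
  unfolding shift_def
proof (rule sum.neutral, rule ballI)
  fix x assume x: "x \<in> A - X"
  show "sgn_at x A * unit_family X (A - {x}) \<tau> +
      (-1) ^ card (A - X) * (sgn_at x X * unit_family (insert x X) A \<tau>) = 0"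
  proof (cases "A = insert x X")
    case True
    then have "A - X = {x}" "A - {x} = X"
      using x by auto
    then show ?thesis
      using True by (simp add: unit_family_def)
  next
    case False
    then have "A - {x} \<noteq> X"
      using x by auto
    then show ?thesis
      using False by (simp add: unit_family_def)
  qed
qed

text \<open>Read the equation for the pair \<open>({}, A)\<close> at the face \<open>A\<close> and
  sum over \<open>A\<close> in \<open>C\<close> with weight \<open>(-1) ^ card A\<close>. Each
  coefficient \<open>\<phi> {} A (insert v A)\<close> enters through \<open>bnd\<close> at
  \<open>A\<close> and through \<open>shift\<close> at \<open>insert v A\<close>, with opposite
  signs, so the sum is 0; the empty face makes it 1.\<close>

lemma no_disjoint_family:
  fixes V :: "'a::linorder set"
  assumes V: "finite V" "C \<subseteq> Pow V" "\<And>A B. A \<in> C \<Longrightarrow> B \<subseteq> A \<Longrightarrow> B \<in> C" and ne: "{} \<in> C"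
    and \<phi>: "\<And>X A. X \<subseteq> A \<Longrightarrow> A \<in> C \<Longrightarrow>
      \<phi> X A \<in> chn (induced C (V - X)) (Suc (card (A - X))) \<and>
      bnd V (\<phi> X A) = (\<lambda>\<tau>. unit_family X A \<tau> - shift \<phi> X A \<tau>)"
  shows False
proof -
  define h where "h = \<phi> {}"
  have finC: "finite C"
    using V by (meson finite_Pow_iff finite_subset)
  have fin: "finite A" if "A \<in> C" for A
    using that V(1,2) by (meson Pow_iff finite_subset subsetD)
  \<comment> \<open>\<open>\<phi> {x} A\<close> avoids \<open>x\<close>, so it has no coefficient at
    \<open>A\<close>; only the terms of \<open>shift\<close> that delete a vertex from
    \<open>A\<close> remain.\<close>
  have diag: "bnd V (h A) A + (\<Sum>x\<in>A. sgn_at x A * h (A - {x}) A) = (if A = {} then 1 else 0)"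
    if A: "A \<in> C" for A
  proof -
    have "\<phi> {x} A A = 0" if "x \<in> A" for x
      using \<phi>[of "{x}" A] that A by (intro chnD[of _ "induced C (V - {x})"]) (auto simp: induced_def)
    then have "shift \<phi> {} A A = (\<Sum>x\<in>A. sgn_at x A * h (A - {x}) A)"
      by (simp add: shift_def h_def)
    then show ?thesis
      using \<phi>[of "{}" A] A by (simp add: h_def unit_family_def)
  qed
  define w :: "_ \<Rightarrow> rat" where "w A = (-1) ^ card A" for A :: "'a set"
  have "(\<Sum>A\<in>C. w A * (bnd V (h A) A + (\<Sum>x\<in>A. sgn_at x A * h (A - {x}) A))) =
      (\<Sum>A\<in>C. if A = {} then 1 else (0::rat))"
    by (intro sum.cong refl) (auto simp: diag w_def)
  also have "\<dots> = 1"
    using ne finC by simp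
  finally have "(\<Sum>A\<in>C. w A * bnd V (h A) A) +
      (\<Sum>A\<in>C. w A * (\<Sum>x\<in>A. sgn_at x A * h (A - {x}) A)) = (1::rat)"
    by (simp add: distrib_left sum.distrib)
  moreover have "(\<Sum>A\<in>C. w A * (\<Sum>x\<in>A. sgn_at x A * h (A - {x}) A)) =
      - (\<Sum>A\<in>C. w A * bnd V (h A) A)"
  proof -
    define f where "f A v = w A * (sgn_at v A * h A (insert v A))" for A v
    have "(\<Sum>A\<in>C. w A * bnd V (h A) A) = (\<Sum>(A, v)\<in>Sigma C (\<lambda>A. V - A). f A v)"
      using V finC by (subst sum.Sigma[symmetric]) (auto simp: bnd_def sum_distrib_left f_def)
    also have "\<dots> = (\<Sum>(A, v)\<in>{(A, v). A \<in> C \<and> v \<notin> A \<and> insert v A \<in> C}. f A v)"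
    proof (rule sum.mono_neutral_right)
      show "finite (Sigma C (\<lambda>A. V - A))"
        using V finC by auto
      show "{(A, v). A \<in> C \<and> v \<notin> A \<and> insert v A \<in> C} \<subseteq> Sigma C (\<lambda>A. V - A)"
        using V by auto
      have "h A (insert v A) = 0" if "A \<in> C" "insert v A \<notin> C" for A v
        using \<phi>[of "{}" A] that
        by (intro chnD[of _ "induced C V"]) (auto simp: induced_def h_def)
      then show "\<forall>p\<in>Sigma C (\<lambda>A. V - A) - {(A, v). A \<in> C \<and> v \<notin> A \<and> insert v A \<in> C}.
          (case p of (A, v) \<Rightarrow> f A v) = 0"
        by (auto simp: f_def) blast
    qed
    \<comment> \<open>Pairs are re-indexed by the larger face: \<open>(A, v)\<close> becomes
      \<open>(insert v A, v)\<close>.\<close>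
    also have "\<dots> = (\<Sum>(A, x)\<in>Sigma C (\<lambda>A. A). f (A - {x}) x)"
    proof (rule sum.reindex_bij_witness[where i = "\<lambda>(A, x). (A - {x}, x)" and j = "\<lambda>(A, x). (insert x A, x)"])
      fix p assume "p \<in> Sigma C (\<lambda>A. A)"
      then show "(case p of (A, x) \<Rightarrow> (A - {x}, x)) \<in> {(A, v). A \<in> C \<and> v \<notin> A \<and> insert v A \<in> C}"
        using V(3) by (auto simp: insert_absorb)
    qed (auto simp: insert_absorb)
    also have "\<dots> = (\<Sum>A\<in>C. \<Sum>x\<in>A. f (A - {x}) x)"
      using finC fin by (subst sum.Sigma) auto
    also have "\<dots> = (\<Sum>A\<in>C. - (w A * (\<Sum>x\<in>A. sgn_at x A * h (A - {x}) A)))"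
    proof (rule sum.cong[OF refl])
      fix A assume A: "A \<in> C"
      have "f (A - {x}) x = - (w A * (sgn_at x A * h (A - {x}) A))" if x: "x \<in> A" for x
      proof -
        have "w A = - w (A - {x})"
          using card_Suc_Diff1[OF fin[OF A] x] unfolding w_def by (metis mult_minus1 power_Suc)
        then show ?thesis
          using x by (simp add: f_def insert_absorb)
      qed
      then show "(\<Sum>x\<in>A. f (A - {x}) x) = - (w A * (\<Sum>x\<in>A. sgn_at x A * h (A - {x}) A))"
        by (simp add: sum_distrib_left sum_negf)
    qed
    finally show ?thesis
      by (simp add: sum_negf)
  qed
  ultimately show False
    by simp
qed

text \<open>The second condition on \<open>U\<close> says that membership in \<open>U\<close> is
  constant along inclusions inside \<open>M - C\<close>. Ruling out a \<open>U\<close> that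
  separates \<open>B\<close> from \<open>B'\<close> means that \<open>M - C\<close>, ordered by
  inclusion, is connected.\<close>

lemma separated_complement_contradiction:
  fixes V :: "'a::linorder set"
  assumes V: "finite V" and C: "C \<subseteq> Pow V" "\<And>A B. A \<in> C \<Longrightarrow> B \<subseteq> A \<Longrightarrow> B \<in> C" and ne: "{} \<in> C"
    and M: "M \<subseteq> Pow V" "\<And>A B. A \<in> M \<Longrightarrow> B \<subseteq> A \<Longrightarrow> B \<in> M"
    and fillC: "\<And>X n. X \<subseteq> V \<Longrightarrow> d < n \<Longrightarrow> fills V (induced C X) n"
    and fillM: "\<And>A n. A \<in> C \<Longrightarrow> n \<le> Suc d \<Longrightarrow> fills V (induced M (V - A)) n"
    and U: "U \<subseteq> M - C" "\<And>\<sigma> \<tau>. \<sigma> \<in> M \<Longrightarrow> \<tau> \<subseteq> \<sigma> \<Longrightarrow> \<tau> \<notin> C \<Longrightarrow> \<sigma> \<in> U \<longleftrightarrow> \<tau> \<in> U"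
    and B: "B \<in> U" "B' \<in> M" "B' \<notin> C" "B' \<notin> U"
  shows False
proof -
  have fin: "finite A" if "A \<in> C" for A
    using that V C(1) by (meson Pow_iff finite_subset subsetD)
  \<comment> \<open>As \<open>S\<close> is not in \<open>C\<close>, no face \<open>X\<close> of
    \<open>C\<close> contains it, so the simplex on \<open>S - X\<close> is nonempty and hence
    acyclic.\<close>
  have simplex_family: "\<exists>\<psi>. \<forall>X A. X \<subseteq> A \<longrightarrow> A \<in> C \<longrightarrow>
      \<psi> X A \<in> chn (Pow (S - X)) (Suc (card (A - X))) \<and>
      bnd V (\<psi> X A) = (\<lambda>\<tau>. unit_family X A \<tau> - shift \<psi> X A \<tau>)"
    if S: "S \<subseteq> V" "S \<notin> C" for S
  proof -
    obtain \<psi> where \<psi>: "\<And>X A. X \<subseteq> A \<Longrightarrow> A \<in> C \<Longrightarrow> card (A - X) \<le> card V \<Longrightarrow>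
        \<psi> X A \<in> chn (Pow (S - X)) (Suc (card (A - X) + 0)) \<and>
        bnd V (\<psi> X A) = (\<lambda>\<tau>. unit_family X A \<tau> + (-1) * shift \<psi> X A \<tau>)"
    proof (rule shift_equation_extend[where G = "\<lambda>X. Pow (S - X)" and k = 0 and m = 0
          and N = "card V" and s = "-1" and \<beta> = unit_family and init = "\<lambda>_ _ _. 0"])
      fix X A assume XA: "X \<subseteq> A" "A \<in> C"
      have "X \<in> C"
        using C(2) XA by blast
      then have "S - X \<noteq> {}"
        using S C(2) by blast
      then show "fills V (Pow (S - X)) (card (A - X) + 0)"
        using S V by (intro fills_Pow) auto
      show "unit_family X A \<in> chn (Pow (S - X)) (card (A - X) + 0)"
        using chn_unit_family[of "Pow (S - X)" X A] by simp
      show "bnd V (unit_family X A) \<tau> = - (-1) * shift unit_family X A \<tau>" for \<tau>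
        using shift_unit_family[OF fin[OF XA(2)] XA(1)] by (simp add: bnd_unit_family)
    qed (use V C in auto)
    have "card (A - X) \<le> card V" if "A \<in> C" for X A
      using that C V by (intro card_mono) auto
    then show ?thesis
      using \<psi> by (intro exI[of _ \<psi>]) auto
  qed
  have BV: "B \<in> M" "B \<notin> C" "B \<subseteq> V" "B' \<subseteq> V"
    using B U M by auto
  obtain \<psi> where \<psi>: "\<And>X A. X \<subseteq> A \<Longrightarrow> A \<in> C \<Longrightarrow>
      \<psi> X A \<in> chn (Pow (B - X)) (Suc (card (A - X)))"
    "\<And>X A \<tau>. X \<subseteq> A \<Longrightarrow> A \<in> C \<Longrightarrow> bnd V (\<psi> X A) \<tau> = unit_family X A \<tau> - shift \<psi> X A \<tau>"
  proof -
    obtain \<chi> where "\<forall>X A. X \<subseteq> A \<longrightarrow> A \<in> C \<longrightarrow>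
        \<chi> X A \<in> chn (Pow (B - X)) (Suc (card (A - X))) \<and>
        bnd V (\<chi> X A) = (\<lambda>\<tau>. unit_family X A \<tau> - shift \<chi> X A \<tau>)"
      using simplex_family[OF BV(3,2)] by blast
    then show ?thesis
      by (intro that[of \<chi>]) auto
  qed
  obtain \<psi>' where \<psi>': "\<And>X A. X \<subseteq> A \<Longrightarrow> A \<in> C \<Longrightarrow>
      \<psi>' X A \<in> chn (Pow (B' - X)) (Suc (card (A - X)))"
    "\<And>X A \<tau>. X \<subseteq> A \<Longrightarrow> A \<in> C \<Longrightarrow> bnd V (\<psi>' X A) \<tau> = unit_family X A \<tau> - shift \<psi>' X A \<tau>"
  proof -
    obtain \<chi> where "\<forall>X A. X \<subseteq> A \<longrightarrow> A \<in> C \<longrightarrow>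
        \<chi> X A \<in> chn (Pow (B' - X)) (Suc (card (A - X))) \<and>
        bnd V (\<chi> X A) = (\<lambda>\<tau>. unit_family X A \<tau> - shift \<chi> X A \<tau>)"
      using simplex_family[OF BV(4) B(3)] by blast
    then show ?thesis
      by (intro that[of \<chi>]) auto
  qed
  let ?G = "\<lambda>X. induced M (V - X)"
  have chnM: "\<psi> X A \<in> chn (?G X) (Suc (card (A - X)))" "\<psi>' X A \<in> chn (?G X) (Suc (card (A - X)))"
    if XA: "X \<subseteq> A" "A \<in> C" for X A
  proof -
    have "Pow (B - X) \<subseteq> ?G X"
      using BV M(2)[OF BV(1)] by (auto simp: induced_def)
    then show "\<psi> X A \<in> chn (?G X) (Suc (card (A - X)))"
      by (rule chn_mono[OF \<psi>(1)[OF XA]])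
    have "Pow (B' - X) \<subseteq> ?G X"
      using BV M(2)[OF B(2)] by (auto simp: induced_def)
    then show "\<psi>' X A \<in> chn (?G X) (Suc (card (A - X)))"
      by (rule chn_mono[OF \<psi>'(1)[OF XA]])
  qed
  \<comment> \<open>The unit terms cancel in the difference of the two families. With
    \<open>k = 1\<close> the fillings have degree \<open>card (A - X) + 1\<close>, and
    \<open>fillM\<close> stops at \<open>Suc d\<close>; hence the bound \<open>d\<close>.\<close>
  obtain H where H: "\<And>X A. X \<subseteq> A \<Longrightarrow> A \<in> C \<Longrightarrow> card (A - X) \<le> d \<Longrightarrow>
      H X A \<in> chn (?G X) (Suc (card (A - X) + 1)) \<and>
      bnd V (H X A) = (\<lambda>\<tau>. (\<psi>' X A \<tau> - \<psi> X A \<tau>) + 1 * shift H X A \<tau>)"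
  proof (rule shift_equation_extend[where G = ?G and k = 1 and m = 0 and N = d and s = 1
        and \<beta> = "\<lambda>X A \<tau>. \<psi>' X A \<tau> - \<psi> X A \<tau>" and init = "\<lambda>_ _ _. 0"])
    fix X A assume XA: "X \<subseteq> A" "A \<in> C" and card: "card (A - X) \<le> d"
    show "fills V (?G X) (card (A - X) + 1)"
      using C(2) XA card by (intro fillM) auto
    show "(\<lambda>\<tau>. \<psi>' X A \<tau> - \<psi> X A \<tau>) \<in> chn (?G X) (card (A - X) + 1)"
      using chnM[OF XA] by (simp add: chn_diff)
    show "bnd V (\<lambda>\<tau>. \<psi>' X A \<tau> - \<psi> X A \<tau>) \<tau> =
        - 1 * shift (\<lambda>X A \<tau>. \<psi>' X A \<tau> - \<psi> X A \<tau>) X A \<tau>" for \<tau>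
      using XA by (simp add: bnd_diff shift_diff \<psi> \<psi>')
  qed (use V C in \<open>auto simp: induced_def\<close>)
  \<comment> \<open>Truncation to \<open>U\<close> commutes with \<open>shift\<close>, which leaves
    the face untouched. It commutes with \<open>bnd\<close> at every face outside \<open>C\<close>,
    because such a face and its cofaces in \<open>M\<close> are in \<open>U\<close> together or not
    at all. The defect therefore lies in \<open>C\<close>.\<close>
  define P where "P X A \<sigma> = (if \<sigma> \<in> U then H X A \<sigma> else 0)" for X A \<sigma>
  have P: "P X A \<in> chn (?G X) (Suc (Suc (card (A - X))))"
    if "X \<subseteq> A" "A \<in> C" "card (A - X) \<le> d" for X A
    using H[OF that] by (auto simp: P_def chn_def)
  \<comment> \<open>\<open>bnd\<close> and \<open>shift\<close> commute and both square to zero, so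
    this correction of \<open>\<psi>\<close> preserves the equation with the unit family.\<close>
  define \<theta> where "\<theta> X A \<tau> = \<psi> X A \<tau> + (bnd V (P X A) \<tau> - shift P X A \<tau>)" for X A \<tau>
  have bnd_P_U: "bnd V (P X A) \<tau> = bnd V (H X A) \<tau>"
    if "X \<subseteq> A" "A \<in> C" "card (A - X) \<le> d" "\<tau> \<in> U" for X A \<tau>
    unfolding bnd_def
  proof (rule sum.cong[OF refl])
    fix v
    have "insert v \<tau> \<in> U" if "insert v \<tau> \<in> M"
      using U(2)[of "insert v \<tau>" \<tau>] U(1) that \<open>\<tau> \<in> U\<close> by auto
    moreover have "H X A (insert v \<tau>) = 0" if "insert v \<tau> \<notin> M"
      using H[of X A] \<open>X \<subseteq> A\<close> \<open>A \<in> C\<close> \<open>card (A - X) \<le> d\<close> that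
      by (intro chnD[of _ "?G X"]) (auto simp: induced_def)
    ultimately show "sgn_at v \<tau> * P X A (insert v \<tau>) = sgn_at v \<tau> * H X A (insert v \<tau>)"
      by (auto simp: P_def)
  qed
  \<comment> \<open>On \<open>U\<close> the family \<open>\<theta>\<close> equals \<open>\<psi>'\<close>, which vanishes there; on \<open>M - C - U\<close> it equals \<open>\<psi>\<close>, which also vanishes.\<close>
  have \<theta>: "\<theta> X A \<in> chn (induced C (V - X)) (Suc (card (A - X) + 0)) \<and>
      bnd V (\<theta> X A) = (\<lambda>\<tau>. unit_family X A \<tau> + (-1) * shift \<theta> X A \<tau>)"
    if XA: "X \<subseteq> A" "A \<in> C" "card (A - X) < Suc d" for X A
  proof
    have card: "card (A - X) \<le> d"
      using XA by simp
    have \<theta>M: "\<theta> X A \<in> chn (?G X) (Suc (card (A - X)))"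
      unfolding \<theta>_def
    proof (intro chn_add chn_diff)
      show "\<psi> X A \<in> chn (?G X) (Suc (card (A - X)))"
        using chnM XA by blast
      show "bnd V (P X A) \<in> chn (?G X) (Suc (card (A - X)))"
        using P[OF XA(1,2) card] M(2) by (intro chn_bnd[OF V]) (auto simp: induced_def)
      have "shift P X A \<in> chn (?G X) (Suc (card (A - X)))"
      proof (rule chn_shift)
        fix x assume x: "x \<in> A - X"
        have sets: "A - {x} - X = (A - X) - {x}" "A - insert x X = (A - X) - {x}"
          by auto
        have cards: "Suc (card (A - {x} - X)) = card (A - X)" "Suc (card (A - insert x X)) = card (A - X)"
          unfolding sets using card_Suc_Diff1[of "A - X" x] x fin[OF XA(2)] by auto
        have "A - {x} \<in> C"
          using C(2) XA(2) by blast
        then show "P X (A - {x}) \<in> chn (?G X) (Suc (card (A - X)))"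
          using P[of X "A - {x}"] x XA card cards by auto
        have "P (insert x X) A \<in> chn (?G (insert x X)) (Suc (card (A - X)))"
          using P[of "insert x X" A] x XA card cards by auto
        then show "P (insert x X) A \<in> chn (?G X) (Suc (card (A - X)))"
          by (rule chn_mono) (auto simp: induced_def)
      qed
      then show "(\<lambda>\<tau>. shift P X A \<tau>) \<in> chn (?G X) (Suc (card (A - X)))" .
    qed
    show "\<theta> X A \<in> chn (induced C (V - X)) (Suc (card (A - X) + 0))"
    proof (rule chnI)
      fix \<tau> assume nz: "\<theta> X A \<tau> \<noteq> 0"
      then have \<tau>: "\<tau> \<in> M" "\<tau> \<subseteq> V - X" "card \<tau> = Suc (card (A - X))"
        using \<theta>M by (auto simp: chn_def induced_def)
      have "\<tau> \<in> C"
      proof (rule ccontr)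
        assume nC: "\<tau> \<notin> C"
        show False
        proof (cases "\<tau> \<in> U")
          case True
          have "shift P X A \<tau> = shift H X A \<tau>"
            using True by (intro shift_cong) (auto simp: P_def)
          then have "\<theta> X A \<tau> = \<psi>' X A \<tau>"
            using H[OF XA(1,2) card] bnd_P_U[OF XA(1,2) card True] by (simp add: \<theta>_def)
          \<comment> \<open>A face of \<open>B'\<close> outside \<open>C\<close> lies in
            \<open>U\<close> only if \<open>B'\<close> does.\<close>
          moreover have "\<not> \<tau> \<subseteq> B'"
            using U(2)[OF B(2) _ nC] True B by auto
          then have "\<psi>' X A \<tau> = 0"
            using \<psi>'(1)[OF XA(1,2)] by (intro chnD) auto
          ultimately show False
            using nz by simp
        next
          case False
          \<comment> \<open>Every face of \<open>B\<close> outside \<open>C\<close> lies in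
            \<open>U\<close>, as \<open>B\<close> does.\<close>
          have "\<not> \<tau> \<subseteq> B"
            using U(2)[OF BV(1) _ nC] False B by auto
          then have "\<psi> X A \<tau> = 0"
            using \<psi>(1)[OF XA(1,2)] by (intro chnD) auto
          moreover have "insert v \<tau> \<notin> U" for v
            using U(2)[of "insert v \<tau>" \<tau>] U(1) False nC by auto
          then have "bnd V (P X A) \<tau> = 0"
            by (simp add: bnd_def P_def)
          moreover have "shift P X A \<tau> = 0"
            using False by (simp add: shift_def P_def)
          ultimately show False
            using nz by (simp add: \<theta>_def)
        qed
      qed
      then show "\<tau> \<in> induced C (V - X) \<and> card \<tau> = Suc (card (A - X) + 0)"
        using \<tau> by (auto simp: induced_def)
    qed
    have bb: "bnd V (bnd V (P X A)) = (\<lambda>_. 0)"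
      using P[OF XA(1,2) card] M(1) by (intro bnd_bnd[OF V]) (auto simp: induced_def)
    have *: "bnd V (\<theta> X A) \<tau> = bnd V (\<psi> X A) \<tau> - shift (\<lambda>X A. bnd V (P X A)) X A \<tau>" for \<tau>
      unfolding \<theta>_def by (simp add: bnd_add bnd_diff bb bnd_shift)
    have "shift \<theta> X A \<tau> = shift \<psi> X A \<tau> + shift (\<lambda>X A. bnd V (P X A)) X A \<tau>" for \<tau>
      unfolding \<theta>_def[abs_def]
      by (simp add: shift_add shift_diff shift_shift[OF fin[OF XA(2)] XA(1)])
    then show "bnd V (\<theta> X A) = (\<lambda>\<tau>. unit_family X A \<tau> + (-1) * shift \<theta> X A \<tau>)"
      using \<psi>(2)[OF XA(1,2)] by (auto simp: * fun_eq_iff)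
  qed
  \<comment> \<open>\<open>\<theta>\<close> settles the pairs with \<open>card (A - X)\<close> at
    most \<open>d\<close>; from \<open>Suc d\<close> on, \<open>fillC\<close> supplies the
    fillings.\<close>
  obtain \<phi> where \<phi>: "\<And>X A. X \<subseteq> A \<Longrightarrow> A \<in> C \<Longrightarrow> card (A - X) \<le> card V \<Longrightarrow>
      \<phi> X A \<in> chn (induced C (V - X)) (Suc (card (A - X) + 0)) \<and>
      bnd V (\<phi> X A) = (\<lambda>\<tau>. unit_family X A \<tau> + (-1) * shift \<phi> X A \<tau>)"
  proof (rule shift_equation_extend[where G = "\<lambda>X. induced C (V - X)" and k = 0 and m = "Suc d"
        and N = "card V" and s = "-1" and \<beta> = unit_family and init = \<theta>])
    fix X A assume XA: "X \<subseteq> A" "A \<in> C"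
    show "unit_family X A \<in> chn (induced C (V - X)) (card (A - X) + 0)"
      using chn_unit_family[of "induced C (V - X)" X A] ne by (simp add: induced_def)
    show "bnd V (unit_family X A) \<tau> = - (-1) * shift unit_family X A \<tau>" for \<tau>
      using shift_unit_family[OF fin[OF XA(2)] XA(1)] by (simp add: bnd_unit_family)
    show "fills V (induced C (V - X)) (card (A - X) + 0)" if "Suc d \<le> card (A - X)"
      using that by (intro fillC) auto
  qed (use V C \<theta> in \<open>auto simp: induced_def\<close>)
  have "card (A - X) \<le> card V" if "A \<in> C" for X A
    using that C V by (intro card_mono) auto
  then show False
    using \<phi> by (intro no_disjoint_family[OF V C ne, where \<phi> = \<phi>]) auto
qed

subsection \<open>Acyclicity of matroid complexes\<close>

lemma matroid_empty: "matroid W M \<Longrightarrow> {} \<in> M"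
  by (simp add: matroid_def)

lemma matroid_finite: "matroid W M \<Longrightarrow> I \<in> M \<Longrightarrow> finite I"
  unfolding matroid_def by (meson finite_subset)

lemma matroid_subset: "matroid W M \<Longrightarrow> I \<in> M \<Longrightarrow> J \<subseteq> I \<Longrightarrow> J \<in> M"
  unfolding matroid_def by blast

lemma matroid_ground: "matroid W M \<Longrightarrow> I \<in> M \<Longrightarrow> I \<subseteq> W"
  unfolding matroid_def by blast

lemma matroid_augment:
  assumes "matroid W M" "I \<in> M" "J \<in> M" "card I < card J"
  obtains x where "x \<in> J - I" "insert x I \<in> M"
  using assms unfolding matroid_def by meson

lemma matroid_extend:
  assumes M: "matroid W M" and J: "J \<in> M"
  shows "I \<in> M \<Longrightarrow> card I \<le> card J \<Longrightarrow> \<exists>K\<in>M. I \<subseteq> K \<and> card K = card J"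
proof (induction "card J - card I" arbitrary: I)
  case 0
  then show ?case
    by (intro bexI[of _ I]) auto
next
  case (Suc k)
  then obtain x where x: "x \<in> J - I" "insert x I \<in> M"
    using matroid_augment[OF M _ J] by (metis zero_less_Suc zero_less_diff)
  then have "card (insert x I) = Suc (card I)"
    using matroid_finite[OF M] Suc.prems(1) by simp
  then have "k = card J - card (insert x I)" "card (insert x I) \<le> card J"
    using Suc.hyps(2) by auto
  then show ?case
    using Suc.hyps(1)[of "insert x I"] x(2) by blast
qed

lemma matroid_induced:
  assumes "matroid W M" "X \<subseteq> W"
  shows "matroid X (induced M X)"
  unfolding matroid_def
proof (intro conjI ballI allI impI)
  show "finite X"
    using assms by (auto simp: matroid_def finite_subset)
  fix A B assume AB: "A \<in> induced M X" "B \<in> induced M X" "card A < card B"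
  then obtain x where "x \<in> B - A" "insert x A \<in> M"
    using matroid_augment[OF assms(1)] by (auto simp: induced_def)
  then show "\<exists>x\<in>B - A. insert x A \<in> induced M X"
    using AB by (intro bexI[of _ x]) (auto simp: induced_def)
qed (use assms matroid_empty matroid_subset in \<open>auto simp: induced_def\<close>)

text \<open>Augmentation is applied to \<open>insert v A\<close> and \<open>insert v B\<close>; both
  contain \<open>v\<close>, so the new element differs from \<open>v\<close>.\<close>

lemma matroid_contract:
  assumes M: "matroid W M" and v: "{v} \<in> M"
  shows "matroid (W - {v}) {I. v \<notin> I \<and> insert v I \<in> M}"
  unfolding matroid_def
proof (intro conjI ballI allI impI)
  show "finite (W - {v})"
    using M by (simp add: matroid_def)
  show "{} \<in> {I. v \<notin> I \<and> insert v I \<in> M}"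
    using v by simp
next
  fix A assume A: "A \<in> {I. v \<notin> I \<and> insert v I \<in> M}"
  then show "A \<subseteq> W - {v}"
    using matroid_ground[OF M] by blast
  fix B assume "B \<subseteq> A"
  then show "B \<in> {I. v \<notin> I \<and> insert v I \<in> M}"
    using A matroid_subset[OF M, of "insert v A" "insert v B"] by blast
next
  fix A B assume AB: "A \<in> {I. v \<notin> I \<and> insert v I \<in> M}" "B \<in> {I. v \<notin> I \<and> insert v I \<in> M}"
    and "card A < card B"
  then have "card (insert v A) < card (insert v B)"
    using matroid_finite[OF M, of "insert v A"] matroid_finite[OF M, of "insert v B"] by simp
  then obtain x where "x \<in> insert v B - insert v A" "insert x (insert v A) \<in> M"
    using matroid_augment[OF M, of "insert v A" "insert v B"] AB by auto
  then show "\<exists>x\<in>B - A. insert x A \<in> {I. v \<notin> I \<and> insert v I \<in> M}"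
    using AB by (intro bexI[of _ x]) (auto simp: insert_commute)
qed

lemma mrank_attained:
  assumes "matroid W M"
  obtains B where "B \<in> M" "B \<subseteq> X" "card B = mrank M X"
proof -
  have "finite M"
    using assms unfolding matroid_def by (meson Pow_iff finite_Pow_iff finite_subset subsetI)
  then have "mrank M X \<in> card ` {A \<in> M. A \<subseteq> X}"
    unfolding mrank_def using matroid_empty[OF assms] by (intro Max_in) auto
  then show ?thesis
    using that by auto
qed

lemma card_le_mrank:
  assumes "matroid W M" "I \<in> M" "I \<subseteq> X"
  shows "card I \<le> mrank M X"
proof -
  have "finite M"
    using assms unfolding matroid_def by (meson Pow_iff finite_Pow_iff finite_subset subsetI)
  then show ?thesis
    unfolding mrank_def using assms by (intro Max_ge) auto
qed

text \<open>For \<open>\<rho>\<close> without \<open>v\<close>, the coefficient of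
  \<open>bnd V c\<close> at \<open>insert v \<rho>\<close> involves only faces through
  \<open>v\<close> and is, up to sign, the boundary of the link chain at
  \<open>\<rho>\<close>.\<close>

lemma bnd_link_cycle:
  assumes "finite V" "K \<subseteq> Pow V" "c \<in> chn K n" "bnd V c = (\<lambda>_. 0)"
  shows "bnd V (\<lambda>\<rho>. if v \<in> \<rho> then 0 else sgn_at v \<rho> * c (insert v \<rho>)) = (\<lambda>_. 0)"
    (is "bnd V ?l = _")
proof
  fix \<rho>
  show "bnd V ?l \<rho> = 0"
  proof (cases "v \<in> \<rho> \<or> \<not> \<rho> \<subseteq> V")
    case True
    have "?l (insert u \<rho>) = 0" for u
    proof (cases "v \<in> \<rho>")
      case False
      then have "insert v (insert u \<rho>) \<notin> K"
        using True assms(2) by auto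
      then show ?thesis
        using chnD[OF assms(3)] by simp
    qed simp
    then show ?thesis
      by (simp add: bnd_def)
  next
    case False
    then have fin: "finite \<rho>" and v: "v \<notin> \<rho>"
      using assms(1) finite_subset by auto
    have "bnd V ?l \<rho> = (\<Sum>u\<in>V - insert v \<rho>. sgn_at u \<rho> * ?l (insert u \<rho>))"
      unfolding bnd_def using assms(1) by (intro sum.mono_neutral_right) auto
    also have "\<dots> = (\<Sum>u\<in>V - insert v \<rho>.
        - sgn_at v \<rho> * (sgn_at u (insert v \<rho>) * c (insert u (insert v \<rho>))))"
    proof (rule sum.cong[OF refl])
      fix u assume u: "u \<in> V - insert v \<rho>"
      then have "sgn_at u \<rho> * sgn_at v (insert u \<rho>) = - (sgn_at v \<rho> * sgn_at u (insert v \<rho>))"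
        using fin v by (intro sgn_at_swap_insert) auto
      then show "sgn_at u \<rho> * ?l (insert u \<rho>) =
          - sgn_at v \<rho> * (sgn_at u (insert v \<rho>) * c (insert u (insert v \<rho>)))"
        using u v by (auto simp: insert_commute simp flip: mult.assoc)
    qed
    also have "\<dots> = - sgn_at v \<rho> * bnd V c (insert v \<rho>)"
      by (simp add: bnd_def sum_distrib_left)
    finally show ?thesis
      using assms(4) by simp
  qed
qed

text \<open>
  Matroid complexes are acyclic below the top dimension. The part of a cycle \<open>c\<close> through a non-loop \<open>v\<close>
  is filled in the contraction by \<open>v\<close>; the remaining cycle \<open>c'\<close> avoids \<open>v\<close>. It is filled in the deletion,
  unless \<open>v\<close> is needed to reach rank above \<open>n\<close>, in which case coning from \<open>v\<close> fills it.
\<close>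

lemma fills_matroid:
  assumes V: "finite V"
  shows "matroid W M \<Longrightarrow> W \<subseteq> V \<Longrightarrow> B \<in> M \<Longrightarrow> n < card B \<Longrightarrow> fills V M n"
proof (induction "card W" arbitrary: W M B n rule: less_induct)
  case less
  note M = \<open>matroid W M\<close>
  have MV: "M \<subseteq> Pow V"
    using matroid_ground[OF M] less.prems(2) by auto
  have finW: "finite W"
    using V less.prems(2) finite_subset by blast
  have "B \<noteq> {}"
    using less.prems(4) by auto
  then obtain v where v: "v \<in> W"
    using matroid_ground[OF M less.prems(3)] by auto
  have smaller: "card (W - {v}) < card W" "W - {v} \<subseteq> V"
    using card_Diff1_less[OF finW v] less.prems(2) by auto
  let ?del = "induced M (W - {v})" and ?con = "{I. v \<notin> I \<and> insert v I \<in> M}"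
  have del: "matroid (W - {v}) ?del"
    using M by (rule matroid_induced) auto
  show ?case
  proof (cases "{v} \<in> M")
    case False
    have "v \<notin> I" if "I \<in> M" for I
      using matroid_subset[OF M that, of "{v}"] False by auto
    then have "?del = M"
      using matroid_ground[OF M] by (auto simp: induced_def)
    then show ?thesis
      using less.hyps[OF smaller(1) del smaller(2), of B n] less.prems by simp
  next
    case vM: True
    have con: "matroid (W - {v}) ?con"
      using matroid_contract[OF M vM] .
    show ?thesis
      unfolding fills_def
    proof (intro ballI impI)
      fix c assume c: "c \<in> chn M n" "bnd V c = (\<lambda>_. 0)"
      show "\<exists>b\<in>chn M (Suc n). bnd V b = c"
      proof (cases n)
        case 0
        \<comment> \<open>In degree 0 there is no link to fill: the chain is a multiple of the empty
          face, and \<open>{v}\<close> is independent.\<close>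
        have "insert v \<sigma> \<in> M" if "\<sigma> \<in> M" "card \<sigma> = n" for \<sigma>
          using that matroid_finite[OF M that(1)] vM 0 by simp
        then have "cone v c \<in> chn M (Suc n)"
          by (intro chn_cone[OF c(1) MV V]) auto
        moreover have "bnd V (cone v c) = c"
          using bnd_cone[OF V MV c(1)] v less.prems(2) c(2) by (auto simp: fun_eq_iff cone_def)
        ultimately show ?thesis
          by blast
      next
        case (Suc m)
        define l where "l \<rho> = (if v \<in> \<rho> then 0 else sgn_at v \<rho> * c (insert v \<rho>))" for \<rho>
        have l: "l \<in> chn ?con m"
        proof (rule chnI)
          fix \<rho> assume "l \<rho> \<noteq> 0"
          then have \<rho>: "v \<notin> \<rho>" "insert v \<rho> \<in> M" "card (insert v \<rho>) = n"
            using c(1) by (auto simp: l_def chn_def split: if_splits)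
          then show "\<rho> \<in> ?con \<and> card \<rho> = m"
            using matroid_finite[OF M \<rho>(2)] Suc by simp
        qed
        have "bnd V l = (\<lambda>_. 0)"
          using bnd_link_cycle[OF V MV c] by (simp add: l_def[abs_def])
        moreover have "fills V ?con m"
        proof -
          \<comment> \<open>Extending \<open>{v}\<close> to the size of \<open>B\<close> and
            removing \<open>v\<close> again gives an independent set of the contraction with more
            than \<open>m\<close> elements.\<close>
          have "card {v} \<le> card B"
            using less.prems(4) by simp
          then obtain K where K: "K \<in> M" "{v} \<subseteq> K" "card K = card B"
            using matroid_extend[OF M less.prems(3) vM] by blast
          have "K - {v} \<in> ?con"
            using K by (simp add: insert_absorb)
          moreover have "m < card (K - {v})"
            using K less.prems(4) Suc matroid_finite[OF M K(1)] by simp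
          ultimately show ?thesis
            by (rule less.hyps[OF smaller(1) con smaller(2)])
        qed
        ultimately obtain b where b: "b \<in> chn ?con (Suc m)" "bnd V b = l"
          using l unfolding fills_def by blast
        have conV: "?con \<subseteq> Pow V"
          using MV by auto
        have coneb: "cone v b \<in> chn M (Suc n)"
          unfolding Suc using b(1) by (rule chn_cone[OF _ conV V]) auto
        define c' where "c' \<sigma> = c \<sigma> + bnd V (cone v b) \<sigma>" for \<sigma>
        have c'M: "c' \<in> chn M n"
          unfolding c'_def
          using c(1) chn_bnd[OF V MV matroid_subset[OF M] coneb] by (rule chn_add)
        \<comment> \<open>By \<open>bnd_cone\<close> the added boundary is
          \<open>b - cone v l\<close>; here \<open>b\<close> avoids \<open>v\<close>, and
          \<open>cone v l\<close> is the part of \<open>c\<close> through \<open>v\<close>.\<close>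
        have c'v: "c' \<sigma> = 0" if "v \<in> \<sigma>" for \<sigma>
        proof -
          have "b \<sigma> = 0"
            using that by (intro chnD[OF b(1)]) auto
          then show ?thesis
            using that bnd_cone[OF V conV b(1), of v \<sigma>] v less.prems(2)
            by (auto simp: c'_def cone_def b(2) l_def insert_absorb)
        qed
        have c': "c' \<in> chn ?del n"
        proof (rule chnI)
          fix \<sigma> assume "c' \<sigma> \<noteq> 0"
          then show "\<sigma> \<in> ?del \<and> card \<sigma> = n"
            using c'M c'v[of \<sigma>] matroid_ground[OF M] by (auto simp: chn_def induced_def)
        qed
        have cyc: "bnd V c' = (\<lambda>_. 0)"
          unfolding c'_def using c(2) bnd_bnd[OF V MV coneb] by (simp add: bnd_add fun_eq_iff)
        obtain e where e: "e \<in> chn M (Suc n)" "bnd V e = c'"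
        proof (cases "\<exists>J\<in>?del. n < card J")
          case True
          then have "fills V ?del n"
            using less.hyps[OF smaller(1) del smaller(2)] by blast
          then obtain e where "e \<in> chn ?del (Suc n)" "bnd V e = c'"
            using c' cyc unfolding fills_def by blast
          moreover have "?del \<subseteq> M"
            by (auto simp: induced_def)
          ultimately show ?thesis
            using that chn_mono by blast
        next
          case False
          have delV: "?del \<subseteq> Pow V"
            using MV by (auto simp: induced_def)
          have "insert v \<sigma> \<in> M" if \<sigma>: "\<sigma> \<in> ?del" "card \<sigma> = n" for \<sigma>
          proof -
            have \<sigma>M: "\<sigma> \<in> M" "\<sigma> \<subseteq> W - {v}"
              using \<sigma> by (auto simp: induced_def)
            \<comment> \<open>Some element of the larger set \<open>B\<close> can be added to
              \<open>\<sigma>\<close>; were it not \<open>v\<close>, the deletion would contain an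
              independent set with more than \<open>n\<close> elements.\<close>
            obtain x where x: "x \<in> B - \<sigma>" "insert x \<sigma> \<in> M"
              using matroid_augment[OF M \<sigma>M(1) less.prems(3)] \<sigma>(2) less.prems(4) by blast
            have "x = v"
            proof (rule ccontr)
              assume "x \<noteq> v"
              then have "insert x \<sigma> \<in> ?del"
                using x \<sigma>M(2) matroid_ground[OF M x(2)] by (auto simp: induced_def)
              moreover have "n < card (insert x \<sigma>)"
                using x(1) \<sigma>(2) matroid_finite[OF M \<sigma>M(1)] by simp
              ultimately show False
                using False by blast
            qed
            then show ?thesis
              using x(2) by simp
          qed
          then have "cone v c' \<in> chn M (Suc n)"
            by (intro chn_cone[OF c' delV V]) auto
          moreover have "bnd V (cone v c') = c'"
            using bnd_cone[OF V delV c'] v less.prems(2) cyc by (auto simp: fun_eq_iff cone_def)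
          ultimately show ?thesis
            using that by blast
        qed
        have "(\<lambda>\<sigma>. e \<sigma> - cone v b \<sigma>) \<in> chn M (Suc n)"
          using e(1) coneb by (rule chn_diff)
        moreover have "bnd V (\<lambda>\<sigma>. e \<sigma> - cone v b \<sigma>) = c"
          by (simp add: fun_eq_iff bnd_diff e(2) c'_def)
        ultimately show ?thesis
          by blast
      qed
    qed
  qed
qed

subsection \<open>The reconfiguration graph\<close>

text \<open>Adjacency in the reconfiguration graph of \<open>C\<^sup>\<star>\<close> and \<open>M\<^sup>*\<close>, read on the complements.\<close>

definition basis_adj :: "'a set set \<Rightarrow> 'a set set \<Rightarrow> nat \<Rightarrow> 'a set \<Rightarrow> 'a set \<Rightarrow> bool" where
  "basis_adj C M r B B' \<longleftrightarrow> B \<in> M \<and> B' \<in> M \<and> card B = r \<and> card B' = r \<and>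
     B \<inter> B' \<notin> C \<and> Suc (card (B \<inter> B')) = r"

text \<open>Each exchange replaces some \<open>x\<close> in \<open>B - B'\<close> by an element of
  \<open>B'\<close>. Since \<open>I\<close> lies in both bases it survives in
  \<open>B - {x}\<close>, which is therefore outside \<open>C\<close>, so the exchange is an
  edge.\<close>

lemma basis_path_above:
  assumes M: "matroid W M" and C: "\<And>A B. A \<in> C \<Longrightarrow> B \<subseteq> A \<Longrightarrow> B \<in> C"
    and I: "I \<notin> C" "I \<subseteq> B'" and B': "B' \<in> M" "card B' = r"
  shows "B \<in> M \<Longrightarrow> card B = r \<Longrightarrow> I \<subseteq> B \<Longrightarrow> (basis_adj C M r)\<^sup>*\<^sup>* B B'"
proof (induction "card (B - B')" arbitrary: B)
  case 0
  then have "B \<subseteq> B'"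
    using matroid_finite[OF M] by auto
  then have "B = B'"
    using card_subset_eq matroid_finite[OF M] B' 0 by metis
  then show ?case
    by simp
next
  case (Suc k)
  have fin: "finite B"
    using matroid_finite[OF M] Suc.prems by blast
  obtain x where x: "x \<in> B" "x \<notin> B'"
    using Suc.hyps(2) by (metis Diff_iff card.empty ex_in_conv nat.distinct(1))
  have Bx: "B - {x} \<in> M" "Suc (card (B - {x})) = r"
    using matroid_subset[OF M Suc.prems(1)] card_Suc_Diff1[OF fin x(1)] Suc.prems(2) by auto
  then obtain y where y: "y \<in> B' - (B - {x})" "insert y (B - {x}) \<in> M"
    using matroid_augment[OF M Bx(1) B'(1)] B'(2) by (metis lessI)
  define B1 where "B1 = insert y (B - {x})"
  have yB: "y \<notin> B" "y \<in> B'"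
    using x y by auto
  have B1: "B1 \<in> M" "card B1 = r" "I \<subseteq> B1" "B \<inter> B1 = B - {x}"
    using y yB Bx fin x I Suc.prems by (auto simp: B1_def)
  moreover have "I \<subseteq> B - {x}"
    using x I(2) Suc.prems(3) by auto
  then have "B - {x} \<notin> C"
    using C I(1) by blast
  ultimately have "basis_adj C M r B B1"
    using Suc.prems Bx by (simp add: basis_adj_def)
  moreover have "B1 - B' = (B - B') - {x}"
    using yB by (auto simp: B1_def)
  then have "k = card (B1 - B')"
    using Suc.hyps(2) x fin by simp
  then have "(basis_adj C M r)\<^sup>*\<^sup>* B1 B'"
    using Suc.hyps(1) B1 by blast
  ultimately show ?case
    by (rule converse_rtranclp_into_rtranclp)
qed

section \<open>Dual bases and the Alexander dual, read on complements\<close>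

lemma mrank_dual_matroid:
  assumes M: "matroid V M"
  shows "mrank (dual_matroid V M) V = card V - mrank M V"
  unfolding mrank_def[of "dual_matroid V M"]
proof (rule Max_eqI)
  have fin: "finite V"
    using M by (simp add: matroid_def)
  have "{A \<in> dual_matroid V M. A \<subseteq> V} \<subseteq> Pow V"
    by auto
  then show "finite (card ` {A \<in> dual_matroid V M. A \<subseteq> V})"
    using fin by (meson finite_Pow_iff finite_imageI finite_subset)
  show "n \<le> card V - mrank M V" if n: "n \<in> card ` {A \<in> dual_matroid V M. A \<subseteq> V}" for n
  proof -
    obtain A where A: "A \<subseteq> V" "n = card A" "mrank M (V - A) = mrank M V"
      using n by (auto simp: dual_matroid_def)
    obtain B where B: "B \<subseteq> V - A" "card B = mrank M V"
      using mrank_attained[OF M, of "V - A"] A(3) by auto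
    have "mrank M V \<le> card (V - A)"
      using B fin by (metis card_mono finite_Diff)
    then show ?thesis
      using A fin card_mono[OF fin A(1)] by (simp add: card_Diff_subset finite_subset)
  qed
  obtain B where B: "B \<in> M" "B \<subseteq> V" "card B = mrank M V"
    using mrank_attained[OF M, of V] by auto
  have "mrank M B = mrank M V"
  proof (rule antisym)
    show "mrank M V \<le> mrank M B"
      using card_le_mrank[OF M B(1), of B] B(3) by simp
    obtain B1 where "B1 \<in> M" "B1 \<subseteq> B" "card B1 = mrank M B"
      using mrank_attained[OF M] by blast
    then show "mrank M B \<le> mrank M V"
      using card_le_mrank[OF M, of B1 V] B(2) by auto
  qed
  moreover have "V - (V - B) = B"
    using B(2) by auto
  ultimately have "V - B \<in> dual_matroid V M"
    by (simp add: dual_matroid_def)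
  moreover have "card (V - B) = card V - mrank M V"
    using B fin by (simp add: card_Diff_subset finite_subset)
  ultimately show "card V - mrank M V \<in> card ` {A \<in> dual_matroid V M. A \<subseteq> V}"
    by (metis (mono_tags, lifting) Diff_subset image_eqI mem_Collect_eq)
qed

text \<open>If \<open>Y\<close> has the dual rank as its size, \<open>V - Y\<close> has
  \<open>mrank M V\<close> elements, so an independent set of that size inside it must be all of
  it.\<close>

lemma mem_RG_vertices_dual:
  assumes M: "matroid V M"
  shows "Y \<in> RG_vertices V (alexander_dual V C) (dual_matroid V M) \<longleftrightarrow>
    Y \<subseteq> V \<and> V - Y \<in> M \<and> card (V - Y) = mrank M V \<and> V - Y \<notin> C" (is "?L \<longleftrightarrow> ?R")
proof
  have fin: "finite V"
    using M by (simp add: matroid_def)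
  obtain B0 where "B0 \<in> M" "card B0 = mrank M V"
    using mrank_attained[OF M] by blast
  \<comment> \<open>This keeps the natural-number subtraction \<open>card V - mrank M V\<close>
    exact.\<close>
  then have r: "mrank M V \<le> card V"
    using card_mono[OF fin] matroid_ground[OF M] by metis
  {
    assume ?L
    then have Y: "Y \<subseteq> V" "mrank M (V - Y) = mrank M V" "card Y = card V - mrank M V" "V - Y \<notin> C"
      by (auto simp: RG_vertices_def bases_def dual_matroid_def alexander_dual_def
          simp flip: mrank_dual_matroid[OF M])
    obtain B where B: "B \<in> M" "B \<subseteq> V - Y" "card B = mrank M V"
      using mrank_attained[OF M, of "V - Y"] Y(2) by auto
    have "card (V - Y) = mrank M V"
      using Y r fin by (simp add: card_Diff_subset finite_subset)
    moreover have "B = V - Y"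
      using B fin calculation by (intro card_subset_eq) auto
    ultimately show ?R
      using B Y by simp
  next
    assume R: ?R
    have "mrank M (V - Y) = mrank M V"
    proof (rule antisym)
      show "mrank M V \<le> mrank M (V - Y)"
        using card_le_mrank[OF M, of "V - Y" "V - Y"] R by simp
      obtain B1 where "B1 \<in> M" "B1 \<subseteq> V - Y" "card B1 = mrank M (V - Y)"
        using mrank_attained[OF M] by blast
      then show "mrank M (V - Y) \<le> mrank M V"
        using card_le_mrank[OF M, of B1 V] by auto
    qed
    moreover have "card (V - Y) = card V - card Y" "card Y \<le> card V"
      using R fin by (auto simp: card_Diff_subset finite_subset card_mono)
    ultimately show ?L
      using R by (auto simp: RG_vertices_def bases_def mrank_dual_matroid[OF M])
        (auto simp: dual_matroid_def alexander_dual_def)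
  }
qed

text \<open>The union of the complements is the complement of \<open>B \<inter> B'\<close>, so one
  element below the rank becomes one above the dual rank. \<open>B\<close> and \<open>B'\<close> are
  outside \<open>C\<close> because their intersection is.\<close>

lemma RG_adj_of_basis_adj:
  assumes M: "matroid V M" and C: "\<And>A B. A \<in> C \<Longrightarrow> B \<subseteq> A \<Longrightarrow> B \<in> C"
    and adj: "basis_adj C M (mrank M V) B B'"
  shows "RG_adj V (alexander_dual V C) (dual_matroid V M) (V - B) (V - B')"
proof -
  have fin: "finite V"
    using M by (simp add: matroid_def)
  have B: "B \<in> M" "B' \<in> M" "card B = mrank M V" "card B' = mrank M V" "B \<inter> B' \<notin> C"
    "Suc (card (B \<inter> B')) = mrank M V"
    using adj by (auto simp: basis_adj_def)
  have sub: "B \<subseteq> V" "B' \<subseteq> V"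
    using B matroid_ground[OF M] by auto
  then have dbl: "V - (V - B) = B" "V - (V - B') = B'"
    by auto
  have "B \<notin> C" "B' \<notin> C"
    using C[of B "B \<inter> B'"] C[of B' "B \<inter> B'"] B(5) by auto
  moreover have un: "(V - B) \<union> (V - B') = V - (B \<inter> B')"
    by auto
  moreover have "V - (V - (B \<inter> B')) = B \<inter> B'"
    using sub by auto
  moreover have "card (V - (B \<inter> B')) = card V - mrank M V + 1"
  proof -
    have "card (V - (B \<inter> B')) = card V - card (B \<inter> B')"
      using sub fin by (intro card_Diff_subset) (auto intro: finite_subset)
    moreover have "mrank M V \<le> card V"
      using card_mono[OF fin sub(1)] B(3) by simp
    ultimately show ?thesis
      using B(6) by simp
  qed
  ultimately show ?thesis
    using B by (simp add: RG_adj_def mem_RG_vertices_dual[OF M] dbl mrank_dual_matroid[OF M])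
      (simp add: alexander_dual_def)
qed

theorem theorem7p7:
  fixes V :: "'a::linorder set" and C M :: "'a set set" and d :: nat
  assumes "finite V"
    and "simplicial_complex V C"
    and "matroid V M"
    and "leray V C d"
    and "\<forall>A\<in>C. mrank M (V - A) \<ge> d + 2"
  shows "RG_connected V (alexander_dual V C) (dual_matroid V M)"
proof -
  note V = \<open>finite V\<close> and M = \<open>matroid V M\<close>
  have CV: "C \<subseteq> Pow V" and C: "\<And>A B. A \<in> C \<Longrightarrow> B \<subseteq> A \<Longrightarrow> B \<in> C"
    using assms(2) unfolding simplicial_complex_def by blast+
  have MV: "M \<subseteq> Pow V"
    using matroid_ground[OF M] by auto
  define r where "r = mrank M V"
  let ?reach = "(basis_adj C M r)\<^sup>*\<^sup>*"
  have path: "?reach B B'"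
    if B: "B \<in> M" "card B = r" "B \<notin> C" and B': "B' \<in> M" "card B' = r" "B' \<notin> C" for B B'
  proof (cases "{} \<in> C")
    case False
    \<comment> \<open>Here \<open>C\<close> is empty, and the empty set serves as the common subset
      outside \<open>C\<close>.\<close>
    show ?thesis
      by (rule basis_path_above[OF M _ False _ B'(1,2) B(1,2)]) (blast intro: C)+
  next
    case ne: True
    define U where "U = {I \<in> M - C. \<exists>P\<in>M. card P = r \<and> I \<subseteq> P \<and> ?reach B P}"
    have U: "\<sigma> \<in> U \<longleftrightarrow> \<tau> \<in> U" if \<sigma>: "\<sigma> \<in> M" "\<tau> \<subseteq> \<sigma>" "\<tau> \<notin> C" for \<sigma> \<tau>
    proof
      assume "\<sigma> \<in> U"
      then show "\<tau> \<in> U"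
        using \<sigma> matroid_subset[OF M] unfolding U_def by blast
    next
      assume "\<tau> \<in> U"
      then obtain P where P: "P \<in> M" "card P = r" "\<tau> \<subseteq> P" "?reach B P"
        by (auto simp: U_def)
      \<comment> \<open>Any basis \<open>Q\<close> above \<open>\<sigma>\<close> will do: it shares
        \<open>\<tau>\<close> with \<open>P\<close>, and \<open>\<tau>\<close> is outside
        \<open>C\<close>, so \<open>basis_path_above\<close> joins the two.\<close>
      have "card \<sigma> \<le> card B"
        using card_le_mrank[OF M \<sigma>(1), of V] matroid_ground[OF M \<sigma>(1)] B(2) by (simp add: r_def)
      then obtain Q where Q: "Q \<in> M" "\<sigma> \<subseteq> Q" "card Q = r"
        using matroid_extend[OF M B(1) \<sigma>(1)] B(2) by auto
      have "?reach P Q"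
        using \<sigma>(2) Q(2)
        by (intro basis_path_above[OF M _ \<sigma>(3) _ Q(1,3) P(1,2,3)]) (blast intro: C)+
      then have "?reach B Q"
        using P(4) by (rule rtranclp_trans[rotated])
      moreover have "\<sigma> \<notin> C"
        using C \<sigma>(2,3) by blast
      ultimately show "\<sigma> \<in> U"
        using Q \<sigma>(1) by (auto simp: U_def)
    qed
    show ?thesis
    proof (rule ccontr)
      assume not_reach: "\<not> ?reach B B'"
      have "B \<in> U"
        using B by (auto simp: U_def)
      moreover have "B' \<notin> U"
      proof
        assume "B' \<in> U"
        then obtain P where P: "P \<in> M" "card P = r" "B' \<subseteq> P" "?reach B P"
          by (auto simp: U_def)
        then have "B' = P"
          using card_subset_eq[OF matroid_finite[OF M P(1)]] B'(2) by metis
        then show False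
          using P(4) not_reach by simp
      qed
      moreover have "fills V (induced C X) n" if X: "X \<subseteq> V" and n: "d < n" for X n
      proof -
        \<comment> \<open>\<open>leray\<close> counts by dimension, \<open>i >= d\<close>, and
          \<open>fills\<close> by cardinality, \<open>n = i + 1 > d\<close>.\<close>
        obtain i where i: "n = Suc i" "d \<le> i"
          using n by (cases n) auto
        have "reduced_homology_vanishes (induced C X) i"
          using assms(4) X i(2) by (auto simp: leray_def)
        then show ?thesis
          unfolding i(1) using CV
          by (intro fills_of_reduced_homology_vanishes[OF V]) (auto simp: induced_def intro: C)
      qed
      moreover have "fills V (induced M (V - A)) n" if A: "A \<in> C" and n: "n \<le> Suc d" for A n
      proof -
        obtain J where J: "J \<in> M" "J \<subseteq> V - A" "card J = mrank M (V - A)"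
          using mrank_attained[OF M] by blast
        have "matroid (V - A) (induced M (V - A))"
          using M by (rule matroid_induced) auto
        moreover have "J \<in> induced M (V - A)"
          using J by (auto simp: induced_def)
        \<comment> \<open>Rank at least \<open>d + 2\<close> exceeds every degree up to
          \<open>d + 1\<close>, exactly the range that the homotopy \<open>H\<close> needs.\<close>
        moreover have "n < card J"
          using assms(5) A J(3) n by fastforce
        ultimately show ?thesis
          using fills_matroid[OF V, of "V - A"] by blast
      qed
      ultimately show False
        using U B' by (intro separated_complement_contradiction[OF V CV C ne MV matroid_subset[OF M],
              where d = d and U = U and B = B and B' = B']) (auto simp: U_def)
    qed
  qed
  show ?thesis
    unfolding RG_connected_def
  proof (intro ballI)
    fix Y Y' assume Y: "Y \<in> RG_vertices V (alexander_dual V C) (dual_matroid V M)"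
      and Y': "Y' \<in> RG_vertices V (alexander_dual V C) (dual_matroid V M)"
    have "?reach (V - Y) (V - Y')"
      using Y Y' by (intro path) (auto simp: mem_RG_vertices_dual[OF M] r_def)
    then have "(RG_adj V (alexander_dual V C) (dual_matroid V M))\<^sup>*\<^sup>* (V - (V - Y)) (V - (V - Y'))"
    proof induction
      case (step P Q)
      have "RG_adj V (alexander_dual V C) (dual_matroid V M) (V - P) (V - Q)"
        using step.hyps(2) unfolding r_def by (rule RG_adj_of_basis_adj[OF M, rotated]) (rule C)
      with step.IH show ?case
        by (rule rtranclp.rtrancl_into_rtrancl)
    qed simp
    moreover have "V - (V - Y) = Y" "V - (V - Y') = Y'"
      using Y Y' by (auto simp: mem_RG_vertices_dual[OF M])
    ultimately show "(RG_adj V (alexander_dual V C) (dual_matroid V M))\<^sup>*\<^sup>* Y Y'"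
      by simp
  qed
qed

end
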